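(* For each of the families (G1.2) (partitions $\lambda(1)=(4,3,2^3)$ and $\lambda(3)=(4,3,2^2,1^2)$ of $13$) and (G4) (partition $\lambda(4)=(4,3^2,1^3)$ of $13$) described in the context, there exist values of the complex coefficients such that $f_3=0$, i.e. $f=f_4$ and $g=g_4+g_3$ (with $g_3\neq 0$), and $$I_0(f,g)=13 .$$
   Context: All coefficients $C_{hk}^{rs}$ are complex numbers. The families below consist of local representations $f\,dy+g\,dz$ (chart $x=1$) at $[1:0:0]$, of algebraic multiplicity $3$ (i.e. all homogeneous components of $f,g$ of degree $\le 2$ vanish and $(f_3,g_3)\neq(0,0)$), of degree-3 foliation $1$-forms $A\,dx+B\,dy+C\,dz$ on $\mathbb{CP}^2$ with $A,B,C$ homogeneous of degree $4$, $xA+yB+zC=0$, $f=B(1,y,z)$, $g=C(1,y,z)$. Here $f_i,g_i$ are the homogeneous components of degree $i$. (G1.2) partitions $\lambda(1)=(4,3,2^3)$ and $\lambda(3)=(4,3,2^2,1^2)$ (which give the same local form), leading terms $\{y^2z^2,-y^3z,y^4\}$, with $(C_{03}^{40},C_{13}^{40})\neq(0,0)$: $f=-y^{3}z-C_{13}^{40}z^{4}-C_{30}^{40}y^{2}z-(C_{21}^{40}+1)yz^{2}+C_{03}^{31}z^{3}$, $g=y^{4}+C_{13}^{40}yz^{3}+C_{30}^{40}y^{3}+C_{21}^{40}y^{2}z+C_{12}^{40}yz^{2}+C_{03}^{40}z^{3}$. (G4) partition $\lambda(4)=(4,3^2,1^3)$, leading terms $\{yz^3,-y^3z,y^4\}$,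 with $C_{03}^{40}\neq 0$: $f=-y^{3}z-C_{30}^{40}y^{2}z+C_{12}^{31}yz^{2}-(C_{12}^{40}+1)z^{3}$, $g=y^{4}+C_{30}^{40}y^{3}+C_{21}^{40}y^{2}z+C_{12}^{40}yz^{2}+C_{03}^{40}z^{3}$. $I_0(f,g)=\dim_{\mathbb{C}}\mathcal{O}_{\mathbb{C}^2,(0,0)}/\langle f,g\rangle$ is the intersection index of $f$ and $g$ at the origin. *)

theory Defs
  imports
    "HOL-Analysis.Analysis"
    "HOL-Algebra.Embedded_Algebras"
    "HOL-Library.Extended_Nat"
    "HOL-Computational_Algebra.Polynomial"
begin

section \<open>Polynomials in two and three variables\<close>

text \<open>
  \<open>complex poly poly\<close> is \<open>\<complex>[y][z]\<close>, with \<open>z\<close> the outer variable, and \<open>complex poly poly poly\<close> is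
  \<open>\<complex>[y][z][x]\<close>, with \<open>x\<close> the outermost variable. So \<open>poly P 1\<close> is the dehomogenization
  \<open>P(1,y,z)\<close>.
\<close>

definition vY :: "complex poly poly" where
  "vY = [:[:0, 1:]:]"

definition vZ :: "complex poly poly" where
  "vZ = [:0, 1:]"

definition cst :: "complex \<Rightarrow> complex poly poly" where
  "cst c = [:[:c:]:]"

definition coeff2 :: "complex poly poly \<Rightarrow> nat \<Rightarrow> nat \<Rightarrow> complex" where
  "coeff2 p j k = Polynomial.coeff (Polynomial.coeff p k) j"

definition hom_comp :: "nat \<Rightarrow> complex poly poly \<Rightarrow> complex poly poly" where
  "hom_comp d p = (\<Sum>j\<le>d. cst (coeff2 p j (d - j)) * vY ^ j * vZ ^ (d - j))"

definition eval2 :: "complex poly poly \<Rightarrow> complex \<times> complex \<Rightarrow> complex" where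
  "eval2 p = (\<lambda>(y, z). poly (poly p [:z:]) y)"

definition homogeneous3 :: "nat \<Rightarrow> complex poly poly poly \<Rightarrow> bool" where
  "homogeneous3 d P \<longleftrightarrow>
     (\<forall>i j k. coeff2 (Polynomial.coeff P i) j k \<noteq> 0 \<longrightarrow> i + j + k = d)"


section \<open>Foliation forms and their local representations\<close>

text \<open>The \<open>1\<close>-form \<open>A dx + B dy + C dz\<close> of a degree \<open>d\<close> foliation on the projective plane.\<close>

definition foliation_form ::
  "nat \<Rightarrow> complex poly poly poly \<Rightarrow> complex poly poly poly \<Rightarrow> complex poly poly poly \<Rightarrow> bool" where
  "foliation_form d A B C \<longleftrightarrow>
     homogeneous3 (d + 1) A \<and> homogeneous3 (d + 1) B \<and> homogeneous3 (d + 1) C \<and>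
     [:0, 1:] * A + [:vY:] * B + [:vZ:] * C = 0"

text \<open>\<open>f dy + g dz\<close> represents, at \<open>[1:0:0]\<close> in the chart \<open>x = 1\<close>, a foliation of degree \<open>d\<close>.\<close>

definition local_representation ::
  "nat \<Rightarrow> complex poly poly \<Rightarrow> complex poly poly \<Rightarrow> bool" where
  "local_representation d f g \<longleftrightarrow>
     (\<exists>A B C. foliation_form d A B C \<and> f = poly B 1 \<and> g = poly C 1)"

definition has_algebraic_multiplicity ::
  "complex poly poly \<Rightarrow> complex poly poly \<Rightarrow> nat \<Rightarrow> bool" where
  "has_algebraic_multiplicity f g m \<longleftrightarrow>
     (\<forall>i<m. hom_comp i f = 0 \<and> hom_comp i g = 0) \<and> (hom_comp m f, hom_comp m g) \<noteq> (0, 0)"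


section \<open>The two families\<close>

text \<open>\<open>C (h, k) (r, s)\<close> stands for the coefficient \<open>C\<close> with lower index \<open>hk\<close> and upper index
  \<open>rs\<close>. Only the finitely many values occurring in the formulas matter.\<close>

type_synonym coefficients = "nat \<times> nat \<Rightarrow> nat \<times> nat \<Rightarrow> complex"

text \<open>Partitions \<open>(4,3,2,2,2)\<close> and \<open>(4,3,2,2,1,1)\<close> of \<open>13\<close>, which share one local form.\<close>

definition family_G1_2 ::
  "coefficients \<Rightarrow> complex poly poly \<Rightarrow> complex poly poly \<Rightarrow> bool" where
  "family_G1_2 C f g \<longleftrightarrow>
     local_representation 3 f g \<and> has_algebraic_multiplicity f g 3 \<and>
     (C (0,3) (4,0), C (1,3) (4,0)) \<noteq> (0, 0) \<and>
     f = - (vY ^ 3 * vZ) - cst (C (1,3) (4,0)) * vZ ^ 4 - cst (C (3,0) (4,0)) * vY ^ 2 * vZ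
         - cst (C (2,1) (4,0) + 1) * vY * vZ ^ 2 + cst (C (0,3) (3,1)) * vZ ^ 3 \<and>
     g = vY ^ 4 + cst (C (1,3) (4,0)) * vY * vZ ^ 3 + cst (C (3,0) (4,0)) * vY ^ 3
         + cst (C (2,1) (4,0)) * vY ^ 2 * vZ + cst (C (1,2) (4,0)) * vY * vZ ^ 2
         + cst (C (0,3) (4,0)) * vZ ^ 3"

text \<open>Partition \<open>(4,3,3,1,1,1)\<close> of \<open>13\<close>.\<close>

definition family_G4 ::
  "coefficients \<Rightarrow> complex poly poly \<Rightarrow> complex poly poly \<Rightarrow> bool" where
  "family_G4 C f g \<longleftrightarrow>
     local_representation 3 f g \<and> has_algebraic_multiplicity f g 3 \<and>
     C (0,3) (4,0) \<noteq> 0 \<and>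
     f = - (vY ^ 3 * vZ) - cst (C (3,0) (4,0)) * vY ^ 2 * vZ
         + cst (C (1,2) (3,1)) * vY * vZ ^ 2 - cst (C (1,2) (4,0) + 1) * vZ ^ 3 \<and>
     g = vY ^ 4 + cst (C (3,0) (4,0)) * vY ^ 3 + cst (C (2,1) (4,0)) * vY ^ 2 * vZ
         + cst (C (1,2) (4,0)) * vY * vZ ^ 2 + cst (C (0,3) (4,0)) * vZ ^ 3"


section \<open>The local ring at the origin and the intersection index\<close>

text \<open>Holomorphic near the origin: complex differentiable at every point of a neighbourhood, i.e.
  the real Frechet derivative is complex linear.\<close>

definition holomorphic_near_0 :: "(complex \<times> complex \<Rightarrow> complex) \<Rightarrow> bool" where
  "holomorphic_near_0 F \<longleftrightarrow>
     (\<exists>U. open U \<and> (0, 0) \<in> U \<and>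
        (\<forall>p\<in>U. \<exists>a b. (F has_derivative (\<lambda>(u, v). a * u + b * v)) (at p)))"

definition holo_ring :: "(complex \<times> complex \<Rightarrow> complex) ring" where
  "holo_ring =
     \<lparr>carrier = {F. holomorphic_near_0 F},
      mult = (\<lambda>F G p. F p * G p), one = (\<lambda>_. 1),
      zero = (\<lambda>_. 0), add = (\<lambda>F G p. F p + G p)\<rparr>"

text \<open>The elements of \<open>holo_ring\<close> are total functions. Dividing out those that vanish near the
  origin yields the ring of germs.\<close>

definition null_germ :: "(complex \<times> complex \<Rightarrow> complex) set" where
  "null_germ = {F \<in> carrier holo_ring. eventually (\<lambda>p. F p = 0) (nhds (0, 0))}"

definition local_ring :: "(complex \<times> complex \<Rightarrow> complex) set ring" where
  "local_ring = holo_ring Quot null_germ"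

definition germ :: "(complex \<times> complex \<Rightarrow> complex) \<Rightarrow> (complex \<times> complex \<Rightarrow> complex) set" where
  "germ F = null_germ +>\<^bsub>holo_ring\<^esub> F"

definition local_ideal ::
  "complex poly poly \<Rightarrow> complex poly poly \<Rightarrow> (complex \<times> complex \<Rightarrow> complex) set set" where
  "local_ideal f g = Idl\<^bsub>local_ring\<^esub> {germ (eval2 f), germ (eval2 g)}"

definition local_algebra ::
  "complex poly poly \<Rightarrow> complex poly poly \<Rightarrow> (complex \<times> complex \<Rightarrow> complex) set set ring" where
  "local_algebra f g = local_ring Quot local_ideal f g"

text \<open>The copy of \<open>\<complex>\<close> inside \<open>local_algebra f g\<close>, over which the dimension is taken.\<close>

definition scalars ::
  "complex poly poly \<Rightarrow> complex poly poly \<Rightarrow> (complex \<times> complex \<Rightarrow> complex) set set set" where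
  "scalars f g = range (\<lambda>c. local_ideal f g +>\<^bsub>local_ring\<^esub> germ (\<lambda>_. c))"

definition intersection_index :: "complex poly poly \<Rightarrow> complex poly poly \<Rightarrow> enat" where
  "intersection_index f g =
     (if ring.finite_dimension (local_algebra f g) (scalars f g) (carrier (local_algebra f g))
      then enat (ring.dim (local_algebra f g) (scalars f g) (carrier (local_algebra f g)))
      else \<infinity>)"

end

(*
  One pair of polynomials serves both families: f = - y^3 z and g = y^4 - y^2 z - y z^2 + z^3.
  In O/(f,g) we have y^3 z = 0, then y^7 = y^3 g = 0, and g trades z^3 for monomials with a higher
  power of y; this leaves the 13 monomials y^i (i < 7), y^i z and y^i z^2 (i < 3).
  If a combination of them equals A f + B g, restrict to y = 0: there g becomes z^3 while the
  combination has degree at most 2 in z, so the terms without y vanish and y divides B.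
  Cancelling y and repeating this three times kills all terms with i < 3 and shows that y^3 divides B;
  the restriction to z = 0 then kills the remaining y^3, ..., y^6, because g becomes y^4.
  The only analytic input is that F(y,z) - F(0,z) is y times a holomorphic function. The quotient
  is given by a Cauchy integral and is complex differentiable by Osgood's lemma.
*)
theory Submission
  imports Defs "HOL-Complex_Analysis.Cauchy_Integral_Formula"
begin

section \<open>Division of holomorphic germs by a coordinate\<close>

text \<open>Origin of the pair: \<open>f_3 = 0\<close> forces the coefficient -1 at
  \<open>y^2 z\<close> in \<open>g\<close> for the first family and at \<open>y z^2\<close> for the
  second, and each family leaves the other of the two free. Taking both equal to -1 therefore
  satisfies both at once. The number 13 is 3 * 3 + 4: \<open>f\<close> is three times the line
  \<open>y = 0\<close>, which \<open>g\<close> meets with multiplicity 3, plus the line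
  \<open>z = 0\<close>, which it meets with multiplicity 4. The basis mirrors this: three layers
  \<open>1, z, z^2\<close> and one layer of four powers of \<open>y\<close>. Obstacle: the local
  ring consists of convergent germs, so spanning has to be shown for every germ and not only for
  polynomials. Since \<open>y^7\<close> and \<open>y^3 z\<close> lie in the ideal exactly, finitely
  many divisions suffice, and no Taylor series has to be summed. The computations use functions and
  equality near the origin; the two nested quotients enter only when the dimension is read
  off.\<close>

text \<open>A parameter integral over a compact interval with jointly continuous integrand.
  \<open>P\<close> is an arbitrary topological space because the parameter is later a pair of
  points.\<close>

lemma continuous_on_contour_integral_circlepath:
  fixes h :: "'a::topological_space \<Rightarrow> complex \<Rightarrow> complex"
  assumes h: "continuous_on (P \<times> sphere a r) (\<lambda>(p, w). h p w)" and "0 \<le> r"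
  shows "continuous_on P (\<lambda>p. contour_integral (circlepath a r) (h p))"
proof -
  have "continuous_on (P \<times> cbox (0::real) 1) (\<lambda>x. h (fst x) (circlepath a r (snd x)))"
    by (rule continuous_on_compose2[OF h[unfolded split_def], of _ "\<lambda>x. (fst x, circlepath a r (snd x))", unfolded fst_conv snd_conv])
       (use \<open>0 \<le> r\<close> in \<open>auto simp: circlepath dist_norm norm_mult intro!: continuous_intros\<close>)
  then have "continuous_on (P \<times> cbox (0::real) 1)
      (\<lambda>(p, t). h p (circlepath a r t) * vector_derivative (circlepath a r) (at t))"
    unfolding split_def vector_derivative_circlepath by (intro continuous_intros)
  from integral_continuous_on_param[OF this]
  show ?thesis by (simp add: contour_integral_integral)
qed

text \<open>On a small disc Cauchy's formula turns \<open>deriv\<close> into a circle integral, and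
  the joint continuity of \<open>f\<close> passes to the integrand and so to the integral.\<close>

lemma continuous_on_deriv_param:
  fixes f :: "'a::metric_space \<Rightarrow> complex \<Rightarrow> complex"
  assumes f: "continuous_on (S \<times> T) (\<lambda>(s, z). f s z)" and "open T"
    and hol: "\<And>s. s \<in> S \<Longrightarrow> f s holomorphic_on T"
  shows "continuous_on (S \<times> T) (\<lambda>(s, z). deriv (f s) z)"
  unfolding continuous_on_eq_continuous_within
proof safe
  fix s z assume s: "s \<in> S" and z: "z \<in> T"
  obtain r where r: "r > 0" "cball z r \<subseteq> T"
    using \<open>open T\<close> z open_contains_cball by blast
  have eq: "deriv (f t) w = 1 / (2 * of_real pi * \<i>) *
      contour_integral (circlepath z r) (\<lambda>u. f t u / (u - w)^2)"
    if "t \<in> S" "w \<in> ball z r" for t w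
  proof (rule DERIV_imp_deriv, rule Cauchy_derivative_integral_circlepath)
    show "f t holomorphic_on ball z r"
      using hol[OF that(1)] r(2) ball_subset_cball holomorphic_on_subset by blast
    show "continuous_on (cball z r) (f t)"
      using hol[OF that(1)] r(2) holomorphic_on_imp_continuous_on continuous_on_subset by blast
  qed (use that in auto)
  have "continuous_on (S \<times> ball z r)
     (\<lambda>p. contour_integral (circlepath z r) (\<lambda>u. f (fst p) u / (u - snd p)^2))"
  proof (rule continuous_on_contour_integral_circlepath)
    show "continuous_on ((S \<times> ball z r) \<times> sphere z r) (\<lambda>(p, w). f (fst p) w / (w - snd p)\<^sup>2)"
      unfolding split_def
    proof (intro continuous_intros)
      show "continuous_on ((S \<times> ball z r) \<times> sphere z r) (\<lambda>x. f (fst (fst x)) (snd x))"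
        by (rule continuous_on_compose2[OF f[unfolded split_def], of _ "\<lambda>x. (fst (fst x), snd x)", unfolded fst_conv snd_conv])
           (use r in \<open>auto intro!: continuous_intros\<close>)
    qed auto
  qed (use r in auto)
  then have "continuous_on (S \<times> ball z r) (\<lambda>p. 1 / (2 * of_real pi * \<i>) * contour_integral (circlepath z r) (\<lambda>u. f (fst p) u / (u - snd p)^2))"
    by (intro continuous_intros)
  then have "continuous_on (S \<times> ball z r) (\<lambda>(s, z). deriv (f s) z)"
    by (rule continuous_on_eq) (auto simp: eq)
  then have "continuous (at (s, z) within S \<times> ball z r) (\<lambda>(s, z). deriv (f s) z)"
    using s r by (simp add: continuous_on_eq_continuous_within)
  \<comment> \<open>Continuity at a point sees \<open>T\<close> only near \<open>z\<close>, so the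
    disc may be exchanged for \<open>T\<close>.\<close>
  moreover have "at (s, z) within S \<times> ball z r = at (s, z) within S \<times> T"
    by (rule at_within_nhd[where S = "UNIV \<times> ball z r"]) (use r in \<open>auto intro: open_Times\<close>)
  ultimately show "continuous (at (s, z) within S \<times> T) (\<lambda>(s, z). deriv (f s) z)"
    by simp
qed

text \<open>Differentiation under the integral sign. The joint continuity of the differentiated
  integrand comes from \<open>continuous_on_deriv_param\<close> with the circle as parameter
  space.\<close>

lemma holomorphic_on_contour_integral_circlepath:
  assumes f: "continuous_on (T \<times> sphere a r) (\<lambda>(z, w). f z w)" and "0 \<le> r" "open T" "convex T"
    and hol: "\<And>w. w \<in> sphere a r \<Longrightarrow> (\<lambda>z. f z w) holomorphic_on T"
  shows "(\<lambda>z. contour_integral (circlepath a r) (f z)) holomorphic_on T"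
  unfolding contour_integral_integral box_real(2)[symmetric]
proof (rule leibniz_rule_holomorphic)
  let ?d = "\<lambda>t. vector_derivative (circlepath a r) (at t)"
  have sph: "circlepath a r t \<in> sphere a r" for t
    using \<open>0 \<le> r\<close> by (simp add: circlepath dist_norm norm_mult)
  have cc: "continuous_on A (circlepath a r)" for A
    unfolding circlepath by (intro continuous_intros)
  have "continuous_on (sphere a r \<times> T) (\<lambda>(w, z). f z w)"
    unfolding split_def
    by (rule continuous_on_compose2[OF f[unfolded split_def], of _ "\<lambda>x. (snd x, fst x)", unfolded fst_conv snd_conv])
       (auto intro!: continuous_intros)
  note D = continuous_on_deriv_param[OF this \<open>open T\<close> hol, unfolded split_def]
  show "((\<lambda>z. f z (circlepath a r t) * ?d t) has_field_derivative
      deriv (\<lambda>z. f z (circlepath a r t)) z * ?d t) (at z within T)"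
    if "z \<in> T" "t \<in> cbox 0 1" for z and t :: real
    by (intro DERIV_cmult_right holomorphic_derivI[OF hol[OF sph] \<open>open T\<close> that(1)])
  show "(\<lambda>t. f z (circlepath a r t) * ?d t) integrable_on cbox 0 1" if "z \<in> T" for z
    unfolding vector_derivative_circlepath
  proof (intro integrable_continuous continuous_intros)
    show "continuous_on (cbox 0 1) (\<lambda>t. f z (circlepath a r t))"
      by (rule continuous_on_compose2[OF f[unfolded split_def], of _ "\<lambda>t. (z, circlepath a r t)", unfolded fst_conv snd_conv])
         (use that sph cc in \<open>auto intro!: continuous_intros simp del: mem_sphere\<close>)
  qed
  show "continuous_on (T \<times> cbox 0 1) (\<lambda>(z, t). deriv (\<lambda>z. f z (circlepath a r t)) z * ?d t)"
    unfolding vector_derivative_circlepath split_def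
  proof (intro continuous_intros)
    show "continuous_on (T \<times> cbox 0 1) (\<lambda>x. deriv (\<lambda>z. f z (circlepath a r (snd x))) (fst x))"
      by (rule continuous_on_compose2[OF D, of _ "\<lambda>x. (circlepath a r (snd x), fst x)", unfolded fst_conv snd_conv])
         (use sph in \<open>auto simp: circlepath intro!: continuous_intros simp del: mem_sphere\<close>)
  qed
qed fact

text \<open>A total derivative exists where one partial derivative exists and the other is jointly
  continuous; Cauchy's formula provides that continuity. \<open>holomorphic_near_0\<close> asks for
  total derivatives, whereas a Cauchy integral with parameters is directly seen to be holomorphic in
  each variable separately.\<close>

lemma osgood:
  assumes S: "open S" and T: "open T" and f: "continuous_on (S \<times> T) (\<lambda>(y, z). f y z)"
    and hy: "\<And>z. z \<in> T \<Longrightarrow> (\<lambda>y. f y z) holomorphic_on S"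
    and hz: "\<And>y. y \<in> S \<Longrightarrow> f y holomorphic_on T"
    and p: "p \<in> S \<times> T"
  shows "\<exists>a b. ((\<lambda>(y, z). f y z) has_derivative (\<lambda>(u, v). a * u + b * v)) (at p)"
proof -
  obtain y z where yz: "p = (y, z)" "y \<in> S" "z \<in> T" using p by auto
  \<comment> \<open>The criterion with partial derivatives wants a convex set in the second
    variable, hence a disc in place of \<open>T\<close>.\<close>
  obtain r where r: "r > 0" "ball z r \<subseteq> T" using T yz open_contains_ball by blast
  have 1: "((\<lambda>y. f y z) has_derivative (*) (deriv (\<lambda>y. f y z) y)) (at y within S)"
    using holomorphic_derivI[OF hy[OF yz(3)] S yz(2)] has_field_derivative_def
      has_derivative_at_withinI by blast
  have 2: "(f s has_derivative blinfun_apply (blinfun_mult_right (deriv (f s) t))) (at t within ball z r)"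
    if "s \<in> S" "t \<in> ball z r" for s t
    using holomorphic_derivI[OF hz[OF that(1)] T, of t] r that has_field_derivative_def
      has_derivative_at_withinI by fastforce
  have "continuous (at (y, z) within S \<times> ball z r) (\<lambda>(s, t). deriv (f s) t)"
    using continuous_on_subset[OF continuous_on_deriv_param[OF f T hz]] yz r
    unfolding continuous_on_eq_continuous_within
    by (meson Sigma_mono continuous_on_eq_continuous_within centre_in_ball mem_Sigma_iff order_refl)
  then have 3: "continuous (at (y, z) within S \<times> ball z r) (\<lambda>(s, t). blinfun_mult_right (deriv (f s) t))"
    unfolding split_def continuous_within
    by (rule bounded_linear.tendsto[OF bounded_linear_blinfun_mult_right])
  have "((\<lambda>(y, z). f y z) has_derivative
      (\<lambda>(u, v). deriv (\<lambda>y. f y z) y * u + blinfun_mult_right (deriv (f y) z) v)) (at (y, z) within S \<times> ball z r)"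
    by (rule has_derivative_partialsI[OF 1 2 3]) (use r in auto)
  moreover have "at (y, z) within S \<times> ball z r = at (y, z)"
    using yz r S by (intro at_within_open) (auto intro: open_Times)
  ultimately show ?thesis unfolding yz by auto
qed

text \<open>Subtract Cauchy's formulas for \<open>F (y, z)\<close> and \<open>F (0, z)\<close>:
  since \<open>1/(w - y) - 1/w = y/(w (w - y))\<close>, a factor \<open>y\<close> comes out, and the
  remaining integral also makes sense at \<open>y = 0\<close>.\<close>

lemma holomorphic_near_0_division:
  assumes "holomorphic_near_0 F"
  shows "\<exists>G. holomorphic_near_0 G \<and> (\<forall>\<^sub>F p in nhds (0, 0). F p = F (0, snd p) + fst p * G p)"
proof -
  obtain U where U: "open U" "(0, 0) \<in> U"
    and dF: "\<And>p. p \<in> U \<Longrightarrow> \<exists>a b. (F has_derivative (\<lambda>(u, v). a * u + b * v)) (at p)"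
    using assms unfolding holomorphic_near_0_def by blast
  obtain A B where AB: "open A" "open B" "(0, 0) \<in> A \<times> B" "A \<times> B \<subseteq> U"
    using open_prod_elim[OF U] by metis
  obtain R where R: "R > 0" "ball 0 R \<subseteq> A \<inter> B"
    using AB by (metis IntI mem_Sigma_iff open_Int open_contains_ball)
  \<comment> \<open>The circle of radius \<open>r\<close> must lie strictly inside the disc of
    radius \<open>R\<close> on which \<open>F\<close> is controlled.\<close>
  define r where "r = R / 2"
  have r: "r > 0" "r < R" using R by (auto simp: r_def)
  have sub: "(y, z) \<in> U" if "norm y < R" "norm z < R" for y z
    using that AB R by (auto simp: subset_iff)
  have contF: "continuous_on (ball 0 R \<times> ball 0 R) F"
    using dF sub has_derivative_continuous
    by (intro continuous_at_imp_continuous_on) (fastforce simp: subset_iff)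
  have dy: "\<exists>a. ((\<lambda>y. F (y, z)) has_field_derivative a) (at y)"
    and dz: "\<exists>b. ((\<lambda>z. F (y, z)) has_field_derivative b) (at z)" if yz: "norm y < R" "norm z < R" for y z
  proof -
    obtain a b where D: "(F has_derivative (\<lambda>(u, v). a * u + b * v)) (at (y, z))"
      using dF[OF sub[OF yz]] by blast
    have "((\<lambda>y. F (y, z)) has_derivative (\<lambda>u. a * u)) (at y)"
      by (rule has_derivative_eq_rhs[OF has_derivative_compose[of "\<lambda>y. (y, z)" "\<lambda>u. (u, 0)", OF _ D]])
         (auto intro!: derivative_eq_intros)
    then show "\<exists>a. ((\<lambda>y. F (y, z)) has_field_derivative a) (at y)"
      by (auto simp: has_field_derivative_def)
    have "((\<lambda>z. F (y, z)) has_derivative (\<lambda>v. b * v)) (at z)"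
      by (rule has_derivative_eq_rhs[OF has_derivative_compose[of "\<lambda>z. (y, z)" "\<lambda>v. (0, v)", OF _ D]])
         (auto intro!: derivative_eq_intros)
    then show "\<exists>b. ((\<lambda>z. F (y, z)) has_field_derivative b) (at z)"
      by (auto simp: has_field_derivative_def)
  qed
  have hy: "(\<lambda>y. F (y, z)) holomorphic_on ball 0 R" if "z \<in> ball 0 R" for z
    using dy that by (auto simp: holomorphic_on_open)
  have hz: "(\<lambda>z. F (y, z)) holomorphic_on ball 0 R" if "y \<in> ball 0 R" for y
    using dz that by (auto simp: holomorphic_on_open)
  \<comment> \<open>The poles \<open>w = 0\<close> and \<open>w = y\<close> lie inside the circle of
    radius \<open>r\<close> when \<open>norm y < r\<close>, so the kernel is continuous on the
    circle itself.\<close>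
  define K where "K = (\<lambda>p w. F (w, snd p) / (w * (w - fst p)))"
  define G where "G = (\<lambda>y z. 1 / (2 * of_real pi * \<i>) * contour_integral (circlepath 0 r) (K (y, z)))"
  have contK: "continuous_on ((ball 0 r \<times> ball 0 R) \<times> sphere 0 r) (\<lambda>(p, w). K p w)"
    unfolding K_def split_def
  proof (intro continuous_intros)
    show "continuous_on ((ball 0 r \<times> ball 0 R) \<times> sphere 0 r) (\<lambda>x. F (snd x, snd (fst x)))"
      by (rule continuous_on_compose2[OF contF])
         (use r in \<open>auto intro!: continuous_intros\<close>)
  qed (use r in auto)
  have contG: "continuous_on (ball 0 r \<times> ball 0 R) (\<lambda>(y, z). G y z)"
    unfolding G_def split_def prod.collapse
    by (intro continuous_intros continuous_on_contour_integral_circlepath contK) (use r in auto)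
  have hGy: "(\<lambda>y. G y z) holomorphic_on ball 0 r" if z: "z \<in> ball 0 R" for z
    unfolding G_def
  proof (intro holomorphic_intros holomorphic_on_contour_integral_circlepath)
    show "continuous_on (ball 0 r \<times> sphere 0 r) (\<lambda>(y, w). K (y, z) w)"
      unfolding split_def
      by (rule continuous_on_compose2[OF contK[unfolded split_def], of _ "\<lambda>x. ((fst x, z), snd x)", unfolded fst_conv snd_conv])
         (use z in \<open>auto intro!: continuous_intros\<close>)
    show "(\<lambda>y. K (y, z) w) holomorphic_on ball 0 r" if "w \<in> sphere 0 r" for w
      unfolding K_def using that r by (auto intro!: holomorphic_intros)
  qed (use r in auto)
  have hGz: "G y holomorphic_on ball 0 R" if y: "y \<in> ball 0 r" for y
    unfolding G_def
  proof (intro holomorphic_intros holomorphic_on_contour_integral_circlepath)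
    show "continuous_on (ball 0 R \<times> sphere 0 r) (\<lambda>(z, w). K (y, z) w)"
      unfolding split_def
      by (rule continuous_on_compose2[OF contK[unfolded split_def], of _ "\<lambda>x. ((y, fst x), snd x)", unfolded fst_conv snd_conv])
         (use y in \<open>auto intro!: continuous_intros\<close>)
    show "(\<lambda>z. K (y, z) w) holomorphic_on ball 0 R" if "w \<in> sphere 0 r" for w
      unfolding K_def using that r y by (auto intro!: holomorphic_intros hz)
  qed (use r in auto)
  have opn: "open (ball 0 r \<times> ball 0 R :: (complex \<times> complex) set)"
    by (intro open_Times) auto
  have "holomorphic_near_0 (\<lambda>(y, z). G y z)"
    unfolding holomorphic_near_0_def
    using osgood[OF open_ball open_ball contG hGy hGz] r opn
    by (intro exI[of _ "ball 0 r \<times> ball 0 R"]) auto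
  moreover have eq: "F (y, z) = F (0, z) + y * G y z" if y: "y \<in> ball 0 r" and z: "z \<in> ball 0 R" for y z
  proof -
    have C: "((\<lambda>w. F (w, z) / (w - x)) has_contour_integral (2 * of_real pi * \<i> * F (x, z))) (circlepath 0 r)"
      if "x \<in> ball 0 r" for x
      by (rule Cauchy_integral_circlepath)
         (use hy[OF z] r that in \<open>auto intro: holomorphic_on_subset holomorphic_on_imp_continuous_on continuous_on_subset\<close>)
    have "((\<lambda>w. F (w, z) / (w - y) - F (w, z) / (w - 0)) has_contour_integral
        (2 * of_real pi * \<i> * F (y, z) - 2 * of_real pi * \<i> * F (0, z))) (circlepath 0 r)"
      using has_contour_integral_diff[OF C[OF y] C[of 0]] r by simp
    then have 1: "((\<lambda>w. y * K (y, z) w) has_contour_integral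
        (2 * of_real pi * \<i> * F (y, z) - 2 * of_real pi * \<i> * F (0, z))) (circlepath 0 r)"
    proof (rule has_contour_integral_eq)
      fix w assume "w \<in> path_image (circlepath 0 r)"
      then have "w \<noteq> 0" "w - y \<noteq> 0" using r y by auto
      then show "F (w, z) / (w - y) - F (w, z) / (w - 0) = y * K (y, z) w"
        by (simp add: K_def frac_eq_eq diff_frac_eq algebra_simps)
    qed
    have "K (y, z) contour_integrable_on circlepath 0 r"
      by (rule contour_integrable_continuous_circlepath)
         (use r y z in \<open>auto intro!: continuous_on_compose2[OF contK[unfolded split_def], of _ "\<lambda>w. ((y, z), w)", unfolded fst_conv snd_conv] continuous_intros\<close>)
    from contour_integral_unique[OF has_contour_integral_lmul[OF has_contour_integral_integral[OF this], of y]]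
         contour_integral_unique[OF 1]
    have "y * contour_integral (circlepath 0 r) (K (y, z)) =
       2 * of_real pi * \<i> * F (y, z) - 2 * of_real pi * \<i> * F (0, z)"
      by simp
    then show ?thesis unfolding G_def by (simp add: field_simps)
  qed
  moreover have "\<forall>\<^sub>F p in nhds (0, 0). p \<in> (ball 0 r \<times> ball 0 R :: (complex \<times> complex) set)"
    using opn r by (intro eventually_nhds_in_open) auto
  then have "\<forall>\<^sub>F p in nhds (0, 0). F p = F (0, snd p) + fst p * (case p of (y, z) \<Rightarrow> G y z)"
    by eventually_elim (auto simp: eq)
  ultimately show ?thesis by blast
qed

section \<open>Equality of germs\<close>

text \<open>Equality of germs on the level of representatives. The filter is \<open>nhds\<close>,
  not \<open>at\<close>, so values at the origin agree too; that is how constant coefficients are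
  read off.\<close>

definition near_eq :: "(complex \<times> complex \<Rightarrow> complex) \<Rightarrow> (complex \<times> complex \<Rightarrow> complex) \<Rightarrow> bool" (infix "\<sim>\<^sub>0" 50)
  where "F \<sim>\<^sub>0 G \<longleftrightarrow> (\<forall>\<^sub>F p in nhds (0, 0). F p = G p)"

lemma near_eq_refl [simp]: "F \<sim>\<^sub>0 F"
  by (simp add: near_eq_def)

lemma near_eq_sym: "F \<sim>\<^sub>0 G \<Longrightarrow> G \<sim>\<^sub>0 F"
  unfolding near_eq_def by (auto elim: eventually_mono)

lemma near_eq_trans [trans]: "F \<sim>\<^sub>0 G \<Longrightarrow> G \<sim>\<^sub>0 H \<Longrightarrow> F \<sim>\<^sub>0 H"
  unfolding near_eq_def by (erule (1) eventually_elim2) simp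

lemma near_eq_add: "F \<sim>\<^sub>0 F' \<Longrightarrow> G \<sim>\<^sub>0 G' \<Longrightarrow> (\<lambda>p. F p + G p) \<sim>\<^sub>0 (\<lambda>p. F' p + G' p)"
  unfolding near_eq_def by (erule (1) eventually_elim2) simp

lemma near_eq_diff: "F \<sim>\<^sub>0 F' \<Longrightarrow> G \<sim>\<^sub>0 G' \<Longrightarrow> (\<lambda>p. F p - G p) \<sim>\<^sub>0 (\<lambda>p. F' p - G' p)"
  unfolding near_eq_def by (erule (1) eventually_elim2) simp

lemma near_eq_mult: "F \<sim>\<^sub>0 F' \<Longrightarrow> G \<sim>\<^sub>0 G' \<Longrightarrow> (\<lambda>p. F p * G p) \<sim>\<^sub>0 (\<lambda>p. F' p * G' p)"
  unfolding near_eq_def by (erule (1) eventually_elim2) simp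

text \<open>Continuity pulls neighbourhoods of the origin back to neighbourhoods. \<open>L\<close>
  will be the swap of the coordinates or a projection onto an axis.\<close>

lemma near_eq_compose:
  assumes "F \<sim>\<^sub>0 G" "continuous (at (0, 0)) L" "L (0, 0) = (0, 0)"
  shows "(\<lambda>p. F (L p)) \<sim>\<^sub>0 (\<lambda>p. G (L p))"
proof -
  have "filterlim L (nhds (0, 0)) (nhds (0, 0))"
    using assms(2,3) by (metis continuous_at tendsto_at_iff_tendsto_nhds)
  then show ?thesis
    using assms(1) unfolding near_eq_def filterlim_iff by blast
qed

lemma near_eq_0D: "F \<sim>\<^sub>0 G \<Longrightarrow> F (0, 0) = G (0, 0)"
  unfolding near_eq_def by (rule eventually_nhds_x_imp_x)

section \<open>Closure properties of functions holomorphic near the origin\<close>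

lemma holomorphic_near_0_const [intro]: "holomorphic_near_0 (\<lambda>_. c)"
  unfolding holomorphic_near_0_def
  by (intro exI[of _ UNIV]) (auto intro!: exI[of _ 0] derivative_eq_intros)

lemma holomorphic_near_0_fst [intro]: "holomorphic_near_0 fst"
proof -
  have "(fst has_derivative (\<lambda>(u, v). 1 * u + 0 * v)) (at p)" for p :: "complex \<times> complex"
    by (rule has_derivative_eq_rhs[OF has_derivative_fst[OF has_derivative_ident]]) auto
  then show ?thesis unfolding holomorphic_near_0_def by (intro exI[of _ UNIV]) blast
qed

lemma holomorphic_near_0_snd [intro]: "holomorphic_near_0 snd"
proof -
  have "(snd has_derivative (\<lambda>(u, v). 0 * u + 1 * v)) (at p)" for p :: "complex \<times> complex"
    by (rule has_derivative_eq_rhs[OF has_derivative_snd[OF has_derivative_ident]]) auto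
  then show ?thesis unfolding holomorphic_near_0_def by (intro exI[of _ UNIV]) blast
qed

lemma holomorphic_near_0_add [intro]:
  assumes "holomorphic_near_0 F" "holomorphic_near_0 G"
  shows "holomorphic_near_0 (\<lambda>p. F p + G p)"
proof -
  obtain U V where U: "open U" "(0, 0) \<in> U" "\<And>p. p \<in> U \<Longrightarrow> \<exists>a b. (F has_derivative (\<lambda>(u, v). a * u + b * v)) (at p)"
    and V: "open V" "(0, 0) \<in> V" "\<And>p. p \<in> V \<Longrightarrow> \<exists>a b. (G has_derivative (\<lambda>(u, v). a * u + b * v)) (at p)"
    using assms unfolding holomorphic_near_0_def by metis
  have "\<exists>a b. ((\<lambda>p. F p + G p) has_derivative (\<lambda>(u, v). a * u + b * v)) (at p)" if "p \<in> U \<inter> V" for p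
  proof -
    from that U(3) V(3) obtain a b c d
      where "(F has_derivative (\<lambda>(u, v). a * u + b * v)) (at p)"
        and "(G has_derivative (\<lambda>(u, v). c * u + d * v)) (at p)"
      by blast
    from has_derivative_add[OF this]
    have "((\<lambda>p. F p + G p) has_derivative (\<lambda>(u, v). (a + c) * u + (b + d) * v)) (at p)"
      by (rule has_derivative_eq_rhs) (auto simp: algebra_simps)
    then show ?thesis by blast
  qed
  then show ?thesis unfolding holomorphic_near_0_def
    using U V by (intro exI[of _ "U \<inter> V"]) auto
qed

lemma holomorphic_near_0_mult [intro]:
  assumes "holomorphic_near_0 F" "holomorphic_near_0 G"
  shows "holomorphic_near_0 (\<lambda>p. F p * G p)"
proof -
  obtain U V where U: "open U" "(0, 0) \<in> U" "\<And>p. p \<in> U \<Longrightarrow> \<exists>a b. (F has_derivative (\<lambda>(u, v). a * u + b * v)) (at p)"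
    and V: "open V" "(0, 0) \<in> V" "\<And>p. p \<in> V \<Longrightarrow> \<exists>a b. (G has_derivative (\<lambda>(u, v). a * u + b * v)) (at p)"
    using assms unfolding holomorphic_near_0_def by metis
  have "\<exists>a b. ((\<lambda>p. F p * G p) has_derivative (\<lambda>(u, v). a * u + b * v)) (at p)" if "p \<in> U \<inter> V" for p
  proof -
    from that U(3) V(3) obtain a b c d
      where "(F has_derivative (\<lambda>(u, v). a * u + b * v)) (at p)"
        and "(G has_derivative (\<lambda>(u, v). c * u + d * v)) (at p)"
      by blast
    from has_derivative_mult[OF this]
    have "((\<lambda>p. F p * G p) has_derivative
        (\<lambda>(u, v). (F p * c + a * G p) * u + (F p * d + b * G p) * v)) (at p)"
      by (rule has_derivative_eq_rhs) (auto simp: algebra_simps)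
    then show ?thesis by blast
  qed
  then show ?thesis unfolding holomorphic_near_0_def
    using U V by (intro exI[of _ "U \<inter> V"]) auto
qed

lemma holomorphic_near_0_uminus [intro]:
  "holomorphic_near_0 F \<Longrightarrow> holomorphic_near_0 (\<lambda>p. - F p)"
  using holomorphic_near_0_mult[OF holomorphic_near_0_const[of "-1"]] by simp

lemma holomorphic_near_0_diff [intro]:
  "holomorphic_near_0 F \<Longrightarrow> holomorphic_near_0 G \<Longrightarrow> holomorphic_near_0 (\<lambda>p. F p - G p)"
  using holomorphic_near_0_add[OF _ holomorphic_near_0_uminus] by simp

lemma holomorphic_near_0_power [intro]:
  "holomorphic_near_0 F \<Longrightarrow> holomorphic_near_0 (\<lambda>p. F p ^ n)"
  by (induction n) auto

lemma holomorphic_near_0_sum [intro]: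
  "(\<And>i. i \<in> A \<Longrightarrow> holomorphic_near_0 (F i)) \<Longrightarrow> holomorphic_near_0 (\<lambda>p. \<Sum>i\<in>A. F i p)"
  by (induction A rule: infinite_finite_induct) auto

text \<open>One linear substitution covers the restrictions to both axes and the swap of the
  coordinates.\<close>

lemma holomorphic_near_0_compose_linear:
  assumes "holomorphic_near_0 F"
  shows "holomorphic_near_0 (\<lambda>p. F (a * fst p + b * snd p, c * fst p + d * snd p))"
proof -
  define L where "L = (\<lambda>p :: complex \<times> complex. (a * fst p + b * snd p, c * fst p + d * snd p))"
  obtain U where U: "open U" "(0, 0) \<in> U" "\<And>p. p \<in> U \<Longrightarrow> \<exists>a b. (F has_derivative (\<lambda>(u, v). a * u + b * v)) (at p)"
    using assms unfolding holomorphic_near_0_def by metis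
  have DL: "(L has_derivative L) (at p)" for p
    unfolding L_def by (auto intro!: derivative_eq_intros)
  have "continuous_on UNIV L" unfolding L_def by (intro continuous_intros)
  then have "open (L -` U)" using U(1) by (simp add: continuous_on_open_vimage)
  moreover have "\<exists>a b. ((\<lambda>p. F (L p)) has_derivative (\<lambda>(u, v). a * u + b * v)) (at p)" if "p \<in> L -` U" for p
  proof -
    from that U(3) obtain s t where "(F has_derivative (\<lambda>(u, v). s * u + t * v)) (at (L p))"
      by blast
    from has_derivative_compose[OF DL this]
    have "((\<lambda>p. F (L p)) has_derivative (\<lambda>(u, v). (s * a + t * c) * u + (s * b + t * d) * v)) (at p)"
      by (rule has_derivative_eq_rhs) (auto simp: L_def algebra_simps)
    then show ?thesis by blast
  qed
  moreover have "(0, 0) \<in> L -` U" using U(2) by (simp add: L_def)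
  ultimately have "holomorphic_near_0 (\<lambda>p. F (L p))"
    unfolding holomorphic_near_0_def by blast
  then show ?thesis by (simp add: L_def)
qed

lemma holomorphic_near_0_axis_z: "holomorphic_near_0 F \<Longrightarrow> holomorphic_near_0 (\<lambda>p. F (0, snd p))"
  using holomorphic_near_0_compose_linear[of F 0 0 0 1] by simp

lemma holomorphic_near_0_axis_y: "holomorphic_near_0 F \<Longrightarrow> holomorphic_near_0 (\<lambda>p. F (fst p, 0))"
  using holomorphic_near_0_compose_linear[of F 1 0 0 0] by simp

lemma holomorphic_near_0_swap: "holomorphic_near_0 F \<Longrightarrow> holomorphic_near_0 (\<lambda>p. F (snd p, fst p))"
  using holomorphic_near_0_compose_linear[of F 0 1 1 0] by simp

section \<open>Division and cancellation by a coordinate, for germs\<close>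

lemma holomorphic_near_0_division_fst:
  assumes "holomorphic_near_0 F"
  obtains G where "holomorphic_near_0 G" "F \<sim>\<^sub>0 (\<lambda>p. F (0, snd p) + fst p * G p)"
  using holomorphic_near_0_division[OF assms] unfolding near_eq_def by blast

lemma holomorphic_near_0_division_snd:
  assumes "holomorphic_near_0 F"
  obtains G where "holomorphic_near_0 G" "F \<sim>\<^sub>0 (\<lambda>p. F (fst p, 0) + snd p * G p)"
proof -
  obtain G where G: "holomorphic_near_0 G"
    and eq: "(\<lambda>p. F (snd p, fst p)) \<sim>\<^sub>0 (\<lambda>p. F (snd p, 0) + fst p * G p)"
    using holomorphic_near_0_division_fst[OF holomorphic_near_0_swap[OF assms]] by auto
  have "continuous (at (0, 0)) (\<lambda>p :: complex \<times> complex. (snd p, fst p))"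
    by (intro continuous_intros)
  from near_eq_compose[OF eq this] have "F \<sim>\<^sub>0 (\<lambda>p. F (fst p, 0) + snd p * G (snd p, fst p))"
    by simp
  with that holomorphic_near_0_swap[OF G] show ?thesis by blast
qed

lemma near_eq_axis_z: "F \<sim>\<^sub>0 G \<Longrightarrow> (\<lambda>p. F (0, snd p)) \<sim>\<^sub>0 (\<lambda>p. G (0, snd p))"
  by (erule near_eq_compose[where L = "\<lambda>p. (0, snd p)", simplified])

lemma near_eq_axis_y: "F \<sim>\<^sub>0 G \<Longrightarrow> (\<lambda>p. F (fst p, 0)) \<sim>\<^sub>0 (\<lambda>p. G (fst p, 0))"
  by (erule near_eq_compose[where L = "\<lambda>p. (fst p, 0)", simplified])

text \<open>Off the line \<open>y = 0\<close> one can divide. The line has empty interior, so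
  continuity of \<open>F - G\<close> carries the equality onto it.\<close>

lemma near_eq_cancel_fst:
  assumes "holomorphic_near_0 F" "holomorphic_near_0 G" "(\<lambda>p. fst p * F p) \<sim>\<^sub>0 (\<lambda>p. fst p * G p)"
  shows "F \<sim>\<^sub>0 G"
proof -
  obtain U where U: "open U" "(0, 0) \<in> U"
    "\<And>p. p \<in> U \<Longrightarrow> \<exists>a b. ((\<lambda>p. F p - G p) has_derivative (\<lambda>(u, v). a * u + b * v)) (at p)"
    using holomorphic_near_0_diff[OF assms(1,2)] unfolding holomorphic_near_0_def by (elim exE conjE) blast
  obtain V where V: "open V" "(0, 0) \<in> V" "\<And>p. p \<in> V \<Longrightarrow> fst p * F p = fst p * G p"
    using assms(3) unfolding near_eq_def eventually_nhds by blast
  have "F p - G p = 0" if p: "p \<in> U \<inter> V" for p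
  proof (rule ccontr)
    let ?D = "\<lambda>p. F p - G p"
    assume "?D p \<noteq> 0"
    have "isCont ?D p" using U(3) p has_derivative_continuous by blast
    then have "\<forall>\<^sub>F q in nhds p. ?D q \<noteq> 0"
      using \<open>?D p \<noteq> 0\<close> tendsto_at_iff_tendsto_nhds[of ?D p]
      by (intro tendsto_imp_eventually_ne[of ?D "?D p"]) (auto simp: continuous_at)
    moreover have "\<forall>\<^sub>F q in nhds p. q \<in> V" using V p by (intro eventually_nhds_in_open) auto
    ultimately have "\<forall>\<^sub>F q in nhds p. fst q = 0"
      by eventually_elim (use V(3) in auto)
    \<comment> \<open>Slicing along the first coordinate through \<open>p\<close> would produce a
      nonempty open subset of the complex plane inside \<open>{0}\<close>.\<close>
    moreover have "filterlim (\<lambda>t. (t, snd p)) (nhds p) (nhds (fst p))"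
      using tendsto_Pair[OF filterlim_ident[of "nhds (fst p)"] tendsto_const[of "snd p"]] by simp
    ultimately have "\<forall>\<^sub>F t in nhds (fst p). t = (0::complex)"
      by (auto dest: eventually_compose_filterlim)
    then obtain S where S: "open S" "fst p \<in> S" "\<And>t. t \<in> S \<Longrightarrow> t = 0"
      unfolding eventually_nhds by blast
    then have "S = {0}" by (metis empty_iff insertI1 is_singletonI' is_singleton_the_elem singletonD)
    with S(1) show False by (simp add: not_open_singleton)
  qed
  then show ?thesis unfolding near_eq_def eventually_nhds
    using U V by (intro exI[of _ "U \<inter> V"]) auto
qed

lemma near_eq_cancel_snd:
  assumes "holomorphic_near_0 F" "holomorphic_near_0 G" "(\<lambda>p. snd p * F p) \<sim>\<^sub>0 (\<lambda>p. snd p * G p)"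
  shows "F \<sim>\<^sub>0 G"
proof -
  have c: "continuous (at (0, 0)) (\<lambda>p :: complex \<times> complex. (snd p, fst p))"
    by (intro continuous_intros)
  have "(\<lambda>p. F (snd p, fst p)) \<sim>\<^sub>0 (\<lambda>p. G (snd p, fst p))"
    by (rule near_eq_cancel_fst[OF holomorphic_near_0_swap[OF assms(1)] holomorphic_near_0_swap[OF assms(2)]])
       (use near_eq_compose[OF assms(3) c] in simp)
  from near_eq_compose[OF this c] show ?thesis by simp
qed

section \<open>Spanning and independence modulo an ideal of germs\<close>

lemma near_eq_cong: "F \<sim>\<^sub>0 G \<Longrightarrow> (\<And>p. F p = F' p) \<Longrightarrow> (\<And>p. G p = G' p) \<Longrightarrow> F' \<sim>\<^sub>0 G'"
  by (simp add: near_eq_def)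

lemma near_eq_ext: "(\<And>p. F p = G p) \<Longrightarrow> F \<sim>\<^sub>0 G"
  by (simp add: near_eq_def)

text \<open>The preimage of \<open>local_ideal\<close> among the holomorphic functions;
  \<open>local_ideal_eq\<close> and \<open>residue_class_zero_iff\<close> make the link.\<close>

definition germ_ideal :: "(complex \<times> complex \<Rightarrow> complex) \<Rightarrow> (complex \<times> complex \<Rightarrow> complex) \<Rightarrow> (complex \<times> complex \<Rightarrow> complex) set"
  where "germ_ideal f g = {H. holomorphic_near_0 H \<and>
    (\<exists>A B. holomorphic_near_0 A \<and> holomorphic_near_0 B \<and> H \<sim>\<^sub>0 (\<lambda>p. A p * f p + B p * g p))}"

lemma germ_idealI:
  "holomorphic_near_0 H \<Longrightarrow> holomorphic_near_0 A \<Longrightarrow> holomorphic_near_0 B \<Longrightarrow>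
    H \<sim>\<^sub>0 (\<lambda>p. A p * f p + B p * g p) \<Longrightarrow> H \<in> germ_ideal f g"
  unfolding germ_ideal_def by blast

lemma germ_ideal_add:
  assumes "F \<in> germ_ideal f g" "G \<in> germ_ideal f g"
  shows "(\<lambda>p. F p + G p) \<in> germ_ideal f g"
proof -
  obtain A B C D where "holomorphic_near_0 A" "holomorphic_near_0 B" "holomorphic_near_0 C" "holomorphic_near_0 D"
    and F: "F \<sim>\<^sub>0 (\<lambda>p. A p * f p + B p * g p)" and G: "G \<sim>\<^sub>0 (\<lambda>p. C p * f p + D p * g p)"
    and "holomorphic_near_0 F" "holomorphic_near_0 G"
    using assms unfolding germ_ideal_def by blast
  then show ?thesis
    by (intro germ_idealI[of _ "\<lambda>p. A p + C p" "\<lambda>p. B p + D p"] near_eq_cong[OF near_eq_add[OF F G]])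
       (auto simp: algebra_simps)
qed

lemma germ_ideal_mult:
  assumes "F \<in> germ_ideal f g" "holomorphic_near_0 G"
  shows "(\<lambda>p. G p * F p) \<in> germ_ideal f g"
proof -
  obtain A B where "holomorphic_near_0 A" "holomorphic_near_0 B" "holomorphic_near_0 F"
    and F: "F \<sim>\<^sub>0 (\<lambda>p. A p * f p + B p * g p)"
    using assms unfolding germ_ideal_def by blast
  then show ?thesis using assms(2)
    by (intro germ_idealI[of _ "\<lambda>p. G p * A p" "\<lambda>p. G p * B p"] near_eq_cong[OF near_eq_mult[OF near_eq_refl[of G] F]])
       (auto simp: algebra_simps)
qed

lemma germ_ideal_near_eq:
  assumes "F \<in> germ_ideal f g" "holomorphic_near_0 G" "G \<sim>\<^sub>0 F"
  shows "G \<in> germ_ideal f g"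
  using assms near_eq_trans[OF assms(3)] unfolding germ_ideal_def by blast

text \<open>In terms of representatives: the class of \<open>H\<close> lies in the complex span of
  the classes of \<open>Ms\<close>.\<close>

definition spanned :: "(complex \<times> complex \<Rightarrow> complex) \<Rightarrow> (complex \<times> complex \<Rightarrow> complex) \<Rightarrow> (complex \<times> complex \<Rightarrow> complex) list \<Rightarrow> (complex \<times> complex \<Rightarrow> complex) set"
  where "spanned f g Ms = {H. holomorphic_near_0 H \<and>
     (\<exists>c. (\<lambda>p. H p - (\<Sum>i<length Ms. c i * (Ms ! i) p)) \<in> germ_ideal f g)}"

lemma spanned_add:
  assumes "F \<in> spanned f g Ms" "G \<in> spanned f g Ms"
  shows "(\<lambda>p. F p + G p) \<in> spanned f g Ms"
proof -
  obtain c d where c: "(\<lambda>p. F p - (\<Sum>i<length Ms. c i * (Ms ! i) p)) \<in> germ_ideal f g"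
    and d: "(\<lambda>p. G p - (\<Sum>i<length Ms. d i * (Ms ! i) p)) \<in> germ_ideal f g"
    and hol: "holomorphic_near_0 F" "holomorphic_near_0 G"
    using assms unfolding spanned_def by blast
  have "(\<lambda>p. F p + G p - (\<Sum>i<length Ms. (c i + d i) * (Ms ! i) p)) \<in> germ_ideal f g"
    using germ_ideal_add[OF c d] by (simp add: algebra_simps sum.distrib)
  with hol show ?thesis unfolding spanned_def by (auto intro!: exI[of _ "\<lambda>i. c i + d i"])
qed

lemma spanned_cmult:
  assumes "F \<in> spanned f g Ms"
  shows "(\<lambda>p. k * F p) \<in> spanned f g Ms"
proof -
  obtain c where c: "(\<lambda>p. F p - (\<Sum>i<length Ms. c i * (Ms ! i) p)) \<in> germ_ideal f g"
    and hol: "holomorphic_near_0 F"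
    using assms unfolding spanned_def by blast
  have "(\<lambda>p. k * F p - (\<Sum>i<length Ms. (k * c i) * (Ms ! i) p)) \<in> germ_ideal f g"
    using germ_ideal_mult[OF c holomorphic_near_0_const[of k]] by (simp add: algebra_simps sum_distrib_left)
  with hol show ?thesis unfolding spanned_def by (auto intro!: exI[of _ "\<lambda>i. k * c i"])
qed

lemma spanned_near_eq:
  assumes "F \<in> spanned f g Ms" "holomorphic_near_0 G" "G \<sim>\<^sub>0 F"
    and "\<And>M. M \<in> set Ms \<Longrightarrow> holomorphic_near_0 M"
  shows "G \<in> spanned f g Ms"
proof -
  obtain c where c: "(\<lambda>p. F p - (\<Sum>i<length Ms. c i * (Ms ! i) p)) \<in> germ_ideal f g"
    using assms unfolding spanned_def by blast
  have "(\<lambda>p. G p - (\<Sum>i<length Ms. c i * (Ms ! i) p)) \<in> germ_ideal f g"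
    by (rule germ_ideal_near_eq[OF c _ near_eq_diff[OF assms(3) near_eq_refl]])
       (use assms(2,4) in \<open>auto intro!: holomorphic_near_0_diff holomorphic_near_0_sum holomorphic_near_0_mult\<close>)
  with assms(2) show ?thesis unfolding spanned_def by blast
qed

lemma germ_ideal_subset_spanned: "F \<in> germ_ideal f g \<Longrightarrow> F \<in> spanned f g Ms"
proof -
  assume F: "F \<in> germ_ideal f g"
  then have "(\<lambda>p. F p - (\<Sum>i<length Ms. 0 * (Ms ! i) p)) \<in> germ_ideal f g" by simp
  moreover have "holomorphic_near_0 F" using F by (simp add: germ_ideal_def)
  ultimately show ?thesis unfolding spanned_def by (intro CollectI conjI exI[of _ "\<lambda>_. 0"])
qed

lemma member_spanned:
  assumes "M \<in> set Ms" "holomorphic_near_0 M"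
  shows "M \<in> spanned f g Ms"
proof -
  obtain j where j: "j < length Ms" "M = Ms ! j" using assms(1) by (auto simp: in_set_conv_nth)
  have "(\<Sum>i<length Ms. (if i = j then 1 else 0) * (Ms ! i) p) = M p" for p
    using j by (simp add: if_distrib[where f = "\<lambda>x. x * _"] cong: if_cong)
  then have "(\<lambda>p. M p - (\<Sum>i<length Ms. (if i = j then 1 else 0) * (Ms ! i) p)) \<in> germ_ideal f g"
    by (auto intro!: germ_idealI[of _ "\<lambda>_. 0" "\<lambda>_. 0"])
  with assms(2) show ?thesis
    unfolding spanned_def by (intro CollectI conjI exI[of _ "\<lambda>i. if i = j then 1 else 0"])
qed

text \<open>A span over the constants is not visibly stable under multiplication by germs. Requiring
  it for all multiples of \<open>H\<close> makes a descent over monomials possible, and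
  \<open>H = 1\<close> gives the spanning claim.\<close>

definition multiples_spanned where
  "multiples_spanned f g Ms H \<longleftrightarrow> (\<forall>F. holomorphic_near_0 F \<longrightarrow> (\<lambda>p. H p * F p) \<in> spanned f g Ms)"

text \<open>Two divisions write every \<open>F\<close> as \<open>F (0, 0) + z K + y G\<close>, so multiples of monomials can be
  treated in order of decreasing degree.\<close>

lemma multiples_spanned_step:
  assumes Ms: "\<And>M. M \<in> set Ms \<Longrightarrow> holomorphic_near_0 M"
    and H: "H \<in> spanned f g Ms"
    and y: "multiples_spanned f g Ms (\<lambda>p. fst p * H p)" and z: "multiples_spanned f g Ms (\<lambda>p. snd p * H p)"
  shows "multiples_spanned f g Ms H"
  unfolding multiples_spanned_def
proof safe
  fix F assume F: "holomorphic_near_0 F"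
  obtain G where G: "holomorphic_near_0 G" "F \<sim>\<^sub>0 (\<lambda>p. F (0, snd p) + fst p * G p)"
    using holomorphic_near_0_division_fst[OF F] by blast
  obtain K where K: "holomorphic_near_0 K" "(\<lambda>p. F (0, snd p)) \<sim>\<^sub>0 (\<lambda>p. F (0, 0) + snd p * K p)"
    using holomorphic_near_0_division_snd[OF holomorphic_near_0_axis_z[OF F]] by auto
  have "F \<sim>\<^sub>0 (\<lambda>p. (F (0, 0) + snd p * K p) + fst p * G p)"
    by (rule near_eq_trans[OF G(2) near_eq_add[OF K(2) near_eq_refl]])
  from near_eq_mult[OF near_eq_refl[of H] this]
  have "(\<lambda>p. H p * F p) \<sim>\<^sub>0 (\<lambda>p. F (0, 0) * H p + (snd p * H p * K p + fst p * H p * G p))"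
    by (rule near_eq_cong) (auto simp: algebra_simps)
  moreover have "(\<lambda>p. F (0, 0) * H p + (snd p * H p * K p + fst p * H p * G p)) \<in> spanned f g Ms"
    using y z G(1) K(1) unfolding multiples_spanned_def
    by (intro spanned_add spanned_cmult H) auto
  moreover have "holomorphic_near_0 H" using H by (simp add: spanned_def)
  ultimately show "(\<lambda>p. H p * F p) \<in> spanned f g Ms"
    using spanned_near_eq[OF _ holomorphic_near_0_mult[OF _ F] _ Ms] by blast
qed

section \<open>The concrete pair: the 13 monomials span and are independent\<close>

definition witness_f :: "complex \<times> complex \<Rightarrow> complex" where
  "witness_f p = - (fst p ^ 3 * snd p)"

definition witness_g :: "complex \<times> complex \<Rightarrow> complex" where
  "witness_g p = fst p ^ 4 - fst p ^ 2 * snd p - fst p * snd p ^ 2 + snd p ^ 3"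

definition monomial :: "nat \<times> nat \<Rightarrow> complex \<times> complex \<Rightarrow> complex" where
  "monomial = (\<lambda>(i, j) p. fst p ^ i * snd p ^ j)"

text \<open>The order fixes the coefficient numbers used in \<open>witness_independent\<close>: 0 to
  6 belong to \<open>y^i\<close>, 7 to 9 to \<open>y^i z\<close>, and 10 to 12 to
  \<open>y^i z^2\<close>.\<close>

definition exponents :: "(nat \<times> nat) list" where
  "exponents = [(0,0), (1,0), (2,0), (3,0), (4,0), (5,0), (6,0), (0,1), (1,1), (2,1), (0,2), (1,2), (2,2)]"

lemma holomorphic_near_0_witness [intro]: "holomorphic_near_0 witness_f" "holomorphic_near_0 witness_g"
  unfolding witness_f_def[abs_def] witness_g_def[abs_def]
  by (intro holomorphic_near_0_uminus holomorphic_near_0_add holomorphic_near_0_diff holomorphic_near_0_mult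
      holomorphic_near_0_power holomorphic_near_0_fst holomorphic_near_0_snd)+

lemma holomorphic_near_0_monomial [intro]: "holomorphic_near_0 (monomial e)"
  unfolding monomial_def split_def
  by (intro holomorphic_near_0_mult holomorphic_near_0_power holomorphic_near_0_fst holomorphic_near_0_snd)

text \<open>\<open>step\<close> at \<open>(i, j)\<close> needs the neighbours
  \<open>(i + 1, j)\<close> and \<open>(i, j + 1)\<close>, while \<open>red\<close> leads to higher
  powers of \<open>y\<close>. Hence the powers of \<open>y\<close> are treated from 6 down to 0, and
  for each of them the powers of \<open>z\<close> downwards.\<close>

lemma witness_spanned:
  assumes "holomorphic_near_0 F"
  shows "F \<in> spanned witness_f witness_g (map monomial exponents)"
proof -
  let ?Q = "\<lambda>i j. multiples_spanned witness_f witness_g (map monomial exponents) (monomial (i, j))"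
  have step: "?Q i j" if "?Q (Suc i) j" "?Q i (Suc j)" "(i, j) \<in> set exponents" for i j
  proof (rule multiples_spanned_step)
    show "monomial (i, j) \<in> spanned witness_f witness_g (map monomial exponents)"
      using that(3) by (intro member_spanned) auto
    show "multiples_spanned witness_f witness_g (map monomial exponents) (\<lambda>p. fst p * monomial (i, j) p)"
      "multiples_spanned witness_f witness_g (map monomial exponents) (\<lambda>p. snd p * monomial (i, j) p)"
      using that(1,2) by (simp_all add: monomial_def multiples_spanned_def mult_ac)
  qed auto
  have f: "?Q (3 + i) (1 + j)" for i j
    unfolding multiples_spanned_def
  proof safe
    fix F assume F: "holomorphic_near_0 F"
    show "(\<lambda>p. monomial (3 + i, 1 + j) p * F p) \<in> spanned witness_f witness_g (map monomial exponents)"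
      by (rule germ_ideal_subset_spanned,
          rule germ_idealI[of _ "\<lambda>p. - (monomial (i, j) p * F p)" "\<lambda>_. 0"])
         (use F in \<open>auto simp: monomial_def witness_f_def power_add mult_ac intro!: holomorphic_near_0_mult holomorphic_near_0_uminus\<close>)
  qed
  \<comment> \<open>Modulo \<open>witness_g\<close>, \<open>z^3\<close> equals
    \<open>- y^4 + y^2 z + y z^2\<close>; the three premises are these terms times
    \<open>y^i z^j\<close>.\<close>
  have red: "?Q i (3 + j)" if "?Q (4 + i) j" "?Q (2 + i) (1 + j)" "?Q (1 + i) (2 + j)" for i j
    unfolding multiples_spanned_def
  proof safe
    fix F assume F: "holomorphic_near_0 F"
    have "(\<lambda>p. (monomial (i, j) p * F p) * witness_g p) \<in> spanned witness_f witness_g (map monomial exponents)"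
      by (rule germ_ideal_subset_spanned,
          rule germ_idealI[of _ "\<lambda>_. 0" "\<lambda>p. monomial (i, j) p * F p"])
         (use F in \<open>auto intro!: holomorphic_near_0_mult\<close>)
    moreover have "(\<lambda>p. (-1) * (monomial (4 + i, j) p * F p)) \<in> spanned witness_f witness_g (map monomial exponents)"
      "(\<lambda>p. monomial (2 + i, 1 + j) p * F p) \<in> spanned witness_f witness_g (map monomial exponents)"
      "(\<lambda>p. monomial (1 + i, 2 + j) p * F p) \<in> spanned witness_f witness_g (map monomial exponents)"
      using that F by (auto simp only: multiples_spanned_def intro!: spanned_cmult)
    ultimately have "(\<lambda>p. (monomial (i, j) p * F p) * witness_g p + ((-1) * (monomial (4 + i, j) p * F p) +
       (monomial (2 + i, 1 + j) p * F p + monomial (1 + i, 2 + j) p * F p))) \<in> spanned witness_f witness_g (map monomial exponents)"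
      by (intro spanned_add)
    then show "(\<lambda>p. monomial (i, 3 + j) p * F p) \<in> spanned witness_f witness_g (map monomial exponents)"
      by (simp add: monomial_def witness_g_def power_add algebra_simps power2_eq_square)
  qed
  have y7: "?Q 7 0"
    unfolding multiples_spanned_def
  proof safe
    fix F assume F: "holomorphic_near_0 F"
    \<comment> \<open>From \<open>y^3 g = y^7 - y^3 z (y^2 + y z - z^2)\<close>; the bracket changes
      sign because \<open>f = - y^3 z\<close>.\<close>
    have "y ^ 7 * w = ((z ^ 2 - y ^ 2 - y * z) * w) * (- (y ^ 3 * z))
        + (y ^ 3 * w) * (y ^ 4 - y ^ 2 * z - y * z ^ 2 + z ^ 3)" for w y z :: complex
      by (simp add: algebra_simps numeral_eq_Suc)
    then show "(\<lambda>p. monomial (7, 0) p * F p) \<in> spanned witness_f witness_g (map monomial exponents)"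
      by (intro germ_ideal_subset_spanned
          germ_idealI[of _ "\<lambda>p. (snd p ^ 2 - fst p ^ 2 - fst p * snd p) * F p" "\<lambda>p. fst p ^ 3 * F p"]
          near_eq_ext holomorphic_near_0_mult holomorphic_near_0_monomial F
          holomorphic_near_0_diff holomorphic_near_0_power holomorphic_near_0_fst holomorphic_near_0_snd)
        (simp_all add: monomial_def witness_f_def witness_g_def)
  qed
  note E = exponents_def
  have y6: "?Q 6 0" using step[of 6 0] f[of 3 0] y7 by (simp add: E)
  have y5: "?Q 5 0" using step[of 5 0] f[of 2 0] y6 by (simp add: E)
  have y4: "?Q 4 0" using step[of 4 0] f[of 1 0] y5 by (simp add: E)
  have y3: "?Q 3 0" using step[of 3 0] f[of 0 0] y4 by (simp add: E)
  \<comment> \<open>\<open>y^2 z^3\<close> is just outside the basis; it reduces to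
    \<open>y^6\<close>, \<open>y^4 z\<close> and \<open>y^3 z^2\<close>, all settled above.\<close>
  have y2z3: "?Q 2 3" using red[of 2 0] y6 f[of 1 0] f[of 0 1] by (simp add: numeral_eq_Suc)
  have y2z2: "?Q 2 2" using step[of 2 2] f[of 0 1] y2z3 by (simp add: E numeral_eq_Suc)
  have y2z: "?Q 2 1" using step[of 2 1] f[of 0 0] y2z2 by (simp add: E numeral_eq_Suc)
  have y2: "?Q 2 0" using step[of 2 0] y3 y2z by (simp add: E numeral_eq_Suc)
  have yz3: "?Q 1 3" using red[of 1 0] y5 f[of 0 0] y2z2 by (simp add: numeral_eq_Suc)
  have yz2: "?Q 1 2" using step[of 1 2] y2z2 yz3 by (simp add: E numeral_eq_Suc)
  have yz: "?Q 1 1" using step[of 1 1] y2z yz2 by (simp add: E numeral_eq_Suc)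
  have y1: "?Q 1 0" using step[of 1 0] y2 yz by (simp add: E numeral_eq_Suc)
  have z3: "?Q 0 3" using red[of 0 0] y4 y2z yz2 by (simp add: numeral_eq_Suc)
  have z2: "?Q 0 2" using step[of 0 2] yz2 z3 by (simp add: E numeral_eq_Suc)
  have z1: "?Q 0 1" using step[of 0 1] yz z2 by (simp add: E numeral_eq_Suc)
  have "?Q 0 0" using step[of 0 0] y1 z1 by (simp add: E numeral_eq_Suc)
  then show ?thesis using assms by (simp add: multiples_spanned_def monomial_def)
qed

text \<open>Evaluate at the origin, cancel one factor \<open>z\<close>, repeat. The last conclusion,
  that \<open>B\<close> vanishes, is what later makes \<open>y\<close> divide the cofactor of
  \<open>g\<close>.\<close>

lemma cancel_z_powers:
  assumes B: "holomorphic_near_0 B"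
    and eq: "(\<lambda>p. a + b * snd p + c * snd p ^ 2) \<sim>\<^sub>0 (\<lambda>p. snd p ^ 3 * B p)"
  shows "a = 0 \<and> b = 0 \<and> c = 0 \<and> B \<sim>\<^sub>0 (\<lambda>_. 0)"
proof -
  note hol = holomorphic_near_0_mult holomorphic_near_0_power holomorphic_near_0_add
    holomorphic_near_0_const holomorphic_near_0_snd B
  have a: "a = 0" using near_eq_0D[OF eq] by simp
  have "(\<lambda>p. b + c * snd p) \<sim>\<^sub>0 (\<lambda>p. snd p ^ 2 * B p)"
    by (rule near_eq_cancel_snd[OF _ _ near_eq_cong[OF eq]])
       (auto intro!: hol simp: a algebra_simps power2_eq_square power3_eq_cube)
  note eq = this
  have b: "b = 0" using near_eq_0D[OF eq] by simp
  have "(\<lambda>p. c) \<sim>\<^sub>0 (\<lambda>p. snd p * B p)"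
    by (rule near_eq_cancel_snd[OF _ _ near_eq_cong[OF eq]])
       (auto intro!: hol simp: b algebra_simps power2_eq_square)
  note eq = this
  have c: "c = 0" using near_eq_0D[OF eq] by simp
  have "B \<sim>\<^sub>0 (\<lambda>_. 0)"
    by (rule near_eq_sym, rule near_eq_cancel_snd[OF _ _ near_eq_cong[OF eq]])
       (auto intro!: hol simp: c)
  with a b c show ?thesis by simp
qed

lemma cancel_y_powers:
  assumes B: "holomorphic_near_0 B"
    and eq: "(\<lambda>p. a + b * fst p + c * fst p ^ 2 + d * fst p ^ 3) \<sim>\<^sub>0 (\<lambda>p. fst p ^ 4 * B p)"
  shows "a = 0 \<and> b = 0 \<and> c = 0 \<and> d = 0"
proof -
  note hol = holomorphic_near_0_mult holomorphic_near_0_power holomorphic_near_0_add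
    holomorphic_near_0_const holomorphic_near_0_fst B
  have a: "a = 0" using near_eq_0D[OF eq] by simp
  have "(\<lambda>p. b + c * fst p + d * fst p ^ 2) \<sim>\<^sub>0 (\<lambda>p. fst p ^ 3 * B p)"
    by (rule near_eq_cancel_fst[OF _ _ near_eq_cong[OF eq]])
       (auto intro!: hol simp: a distrib_left numeral_eq_Suc)
  note eq = this
  have b: "b = 0" using near_eq_0D[OF eq] by simp
  have "(\<lambda>p. c + d * fst p) \<sim>\<^sub>0 (\<lambda>p. fst p ^ 2 * B p)"
    by (rule near_eq_cancel_fst[OF _ _ near_eq_cong[OF eq]])
       (auto intro!: hol simp: b distrib_left numeral_eq_Suc)
  note eq = this
  have c: "c = 0" using near_eq_0D[OF eq] by simp
  have "(\<lambda>p. d) \<sim>\<^sub>0 (\<lambda>p. fst p * B p)"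
    by (rule near_eq_cancel_fst[OF _ _ near_eq_cong[OF eq]])
       (auto intro!: hol simp: c distrib_left numeral_eq_Suc)
  from near_eq_0D[OF this] have "d = 0" by simp
  with a b c show ?thesis by simp
qed

text \<open>On \<open>y = 0\<close> only \<open>z^3 B (0, z)\<close> survives on the right, so the
  quadratic in \<open>z\<close> and \<open>B (0, z)\<close> both vanish. Then
  \<open>B = y D\<close>, and one \<open>y\<close> cancels throughout. The conclusion keeps the form
  of the hypothesis, so the lemma can be iterated while \<open>A\<close> still contains a factor
  \<open>y\<close>.\<close>

lemma fst_divides_coefficient:
  assumes hol: "holomorphic_near_0 A" "holomorphic_near_0 B" "holomorphic_near_0 R" "holomorphic_near_0 g"
    and g: "\<And>z. g (0, z) = z ^ 3"
    and eq: "(\<lambda>p. a + b * snd p + c * snd p ^ 2 + fst p * R p) \<sim>\<^sub>0 (\<lambda>p. fst p * A p + B p * g p)"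
  shows "a = 0 \<and> b = 0 \<and> c = 0 \<and> (\<exists>D. holomorphic_near_0 D \<and> R \<sim>\<^sub>0 (\<lambda>p. A p + D p * g p))"
proof -
  have "(\<lambda>p. a + b * snd p + c * snd p ^ 2) \<sim>\<^sub>0 (\<lambda>p. snd p ^ 3 * B (0, snd p))"
    by (rule near_eq_cong[OF near_eq_axis_z[OF eq]]) (simp_all add: g)
  then have 0: "a = 0" "b = 0" "c = 0" and B0: "(\<lambda>p. B (0, snd p)) \<sim>\<^sub>0 (\<lambda>_. 0)"
    using cancel_z_powers[OF holomorphic_near_0_axis_z[OF hol(2)]] by auto
  obtain D where D: "holomorphic_near_0 D" "B \<sim>\<^sub>0 (\<lambda>p. B (0, snd p) + fst p * D p)"
    using holomorphic_near_0_division_fst[OF hol(2)] by blast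
  have "B \<sim>\<^sub>0 (\<lambda>p. 0 + fst p * D p)"
    by (rule near_eq_trans[OF D(2) near_eq_add[OF B0 near_eq_refl]])
  then have "(\<lambda>p. fst p * A p + B p * g p) \<sim>\<^sub>0 (\<lambda>p. fst p * A p + (0 + fst p * D p) * g p)"
    by (intro near_eq_add near_eq_mult near_eq_refl)
  note e = near_eq_trans[OF eq this]
  have "R \<sim>\<^sub>0 (\<lambda>p. A p + D p * g p)"
    by (rule near_eq_cancel_fst[OF _ _ near_eq_cong[OF e]])
       (auto intro!: holomorphic_near_0_add holomorphic_near_0_mult hol D(1) simp: 0 distrib_left mult.assoc)
  with 0 D(1) show ?thesis by blast
qed

lemma witness_independent:
  assumes "(\<lambda>p. \<Sum>i<length exponents. c i * (map monomial exponents ! i) p) \<in> germ_ideal witness_f witness_g"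
    and "i < length exponents"
  shows "c i = 0"
proof -
  obtain A B where AB: "holomorphic_near_0 A" "holomorphic_near_0 B"
    and eq: "(\<lambda>p. \<Sum>i<length exponents. c i * (map monomial exponents ! i) p) \<sim>\<^sub>0 (\<lambda>p. A p * witness_f p + B p * witness_g p)"
    using assms(1) unfolding germ_ideal_def by blast
  note hol = holomorphic_near_0_mult holomorphic_near_0_power holomorphic_near_0_add holomorphic_near_0_uminus
    holomorphic_near_0_const holomorphic_near_0_fst holomorphic_near_0_snd holomorphic_near_0_witness AB
  have g: "witness_g (0, z) = z ^ 3" for z by (simp add: witness_g_def)
  \<comment> \<open>Horner form in \<open>y\<close>: each level is a quadratic in \<open>z\<close>
    plus \<open>y\<close> times the rest. On the right, the three factors \<open>y\<close> of
    \<open>witness_f\<close> are displayed for the three applications of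
    \<open>fst_divides_coefficient\<close>.\<close>
  have "(\<lambda>p. c 0 + c 7 * snd p + c 10 * snd p ^ 2 + fst p *
      (c 1 + c 8 * snd p + c 11 * snd p ^ 2 + fst p *
      (c 2 + c 9 * snd p + c 12 * snd p ^ 2 + fst p *
      (c 3 + c 4 * fst p + c 5 * fst p ^ 2 + c 6 * fst p ^ 3)))) \<sim>\<^sub>0
    (\<lambda>p. fst p * (fst p * (fst p * - (snd p * A p))) + B p * witness_g p)"
  proof (rule near_eq_cong[OF eq])
    fix p
    have "(\<Sum>i<length exponents. c i * (map monomial exponents ! i) p) =
      c 0 + c 1 * fst p + c 2 * fst p ^ 2 + c 3 * fst p ^ 3 + c 4 * fst p ^ 4 + c 5 * fst p ^ 5 + c 6 * fst p ^ 6
      + c 7 * snd p + c 8 * (fst p * snd p) + c 9 * (fst p ^ 2 * snd p)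
      + c 10 * snd p ^ 2 + c 11 * (fst p * snd p ^ 2) + c 12 * (fst p ^ 2 * snd p ^ 2)"
      by (simp add: exponents_def monomial_def numeral_eq_Suc)
    also have "\<dots> = c 0 + c 7 * snd p + c 10 * snd p ^ 2 + fst p *
      (c 1 + c 8 * snd p + c 11 * snd p ^ 2 + fst p *
      (c 2 + c 9 * snd p + c 12 * snd p ^ 2 + fst p *
      (c 3 + c 4 * fst p + c 5 * fst p ^ 2 + c 6 * fst p ^ 3)))"
    proof -
      have "x ^ 2 = x * x" "x ^ 3 = x * (x * x)" "x ^ 4 = x * (x * (x * x))"
        "x ^ 5 = x * (x * (x * (x * x)))" "x ^ 6 = x * (x * (x * (x * (x * x))))" for x :: complex
        by (simp_all add: numeral_eq_Suc)
      then show ?thesis by (simp add: distrib_left mult_ac add_ac)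
    qed
    finally show "(\<Sum>i<length exponents. c i * (map monomial exponents ! i) p) =
      c 0 + c 7 * snd p + c 10 * snd p ^ 2 + fst p *
      (c 1 + c 8 * snd p + c 11 * snd p ^ 2 + fst p *
      (c 2 + c 9 * snd p + c 12 * snd p ^ 2 + fst p *
      (c 3 + c 4 * fst p + c 5 * fst p ^ 2 + c 6 * fst p ^ 3)))" .
  qed (simp add: witness_f_def power3_eq_cube mult_ac)
  note eq = this
  have R: "holomorphic_near_0 (\<lambda>p. c 3 + c 4 * fst p + c 5 * fst p ^ 2 + c 6 * fst p ^ 3)"
    and A: "holomorphic_near_0 (\<lambda>p. - (snd p * A p))"
    by (intro hol)+
  note R' = holomorphic_near_0_add[OF _ holomorphic_near_0_mult[OF holomorphic_near_0_fst R]]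
  note A' = holomorphic_near_0_mult[OF holomorphic_near_0_fst A]
  have L: "holomorphic_near_0 (\<lambda>p. r + s * snd p + t * snd p ^ 2)" for r s t
    by (intro hol)
  obtain D where 0: "c 0 = 0" "c 7 = 0" "c 10 = 0" and D: "holomorphic_near_0 D"
    and eq: "(\<lambda>p. c 1 + c 8 * snd p + c 11 * snd p ^ 2 + fst p *
      (c 2 + c 9 * snd p + c 12 * snd p ^ 2 + fst p *
      (c 3 + c 4 * fst p + c 5 * fst p ^ 2 + c 6 * fst p ^ 3))) \<sim>\<^sub>0
    (\<lambda>p. fst p * (fst p * - (snd p * A p)) + D p * witness_g p)"
    using fst_divides_coefficient[OF holomorphic_near_0_mult[OF holomorphic_near_0_fst A'] AB(2)
        holomorphic_near_0_add[OF L holomorphic_near_0_mult[OF holomorphic_near_0_fst R'[OF L]]]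
        holomorphic_near_0_witness(2) g eq] by blast
  obtain E where 1: "c 1 = 0" "c 8 = 0" "c 11 = 0" and E: "holomorphic_near_0 E"
    and eq: "(\<lambda>p. c 2 + c 9 * snd p + c 12 * snd p ^ 2 + fst p *
      (c 3 + c 4 * fst p + c 5 * fst p ^ 2 + c 6 * fst p ^ 3)) \<sim>\<^sub>0
    (\<lambda>p. fst p * - (snd p * A p) + E p * witness_g p)"
    using fst_divides_coefficient[OF A' D R'[OF L] holomorphic_near_0_witness(2) g eq] by blast
  obtain K where 2: "c 2 = 0" "c 9 = 0" "c 12 = 0" and K: "holomorphic_near_0 K"
    and eq: "(\<lambda>p. c 3 + c 4 * fst p + c 5 * fst p ^ 2 + c 6 * fst p ^ 3) \<sim>\<^sub>0
    (\<lambda>p. - (snd p * A p) + K p * witness_g p)"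
    using fst_divides_coefficient[OF A E R holomorphic_near_0_witness(2) g eq] by blast
  \<comment> \<open>Restriction to \<open>z = 0\<close> kills \<open>snd p * A p\<close> and turns
    \<open>witness_g\<close> into \<open>y^4\<close>.\<close>
  have "(\<lambda>p. c 3 + c 4 * fst p + c 5 * fst p ^ 2 + c 6 * fst p ^ 3) \<sim>\<^sub>0 (\<lambda>p. fst p ^ 4 * K (fst p, 0))"
    by (rule near_eq_cong[OF near_eq_axis_y[OF eq]]) (simp_all add: witness_g_def)
  from cancel_y_powers[OF holomorphic_near_0_axis_y[OF K] this]
  have 3: "c 3 = 0" "c 4 = 0" "c 5 = 0" "c 6 = 0" by auto
  from 0 1 2 3 assms(2) show ?thesis
    by (auto simp: exponents_def less_Suc_eq numeral_eq_Suc)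
qed

section \<open>The local algebra and its dimension\<close>

lemma holo_ring_simps:
  "carrier holo_ring = Collect holomorphic_near_0"
  "F \<otimes>\<^bsub>holo_ring\<^esub> G = (\<lambda>p. F p * G p)" "\<one>\<^bsub>holo_ring\<^esub> = (\<lambda>_. 1)"
  "F \<oplus>\<^bsub>holo_ring\<^esub> G = (\<lambda>p. F p + G p)" "\<zero>\<^bsub>holo_ring\<^esub> = (\<lambda>_. 0)"
  by (simp_all add: holo_ring_def)

lemma cring_holo_ring: "cring holo_ring"
proof (rule cringI)
  show "abelian_group holo_ring"
  proof (rule abelian_groupI)
    fix F assume "F \<in> carrier holo_ring"
    then show "\<exists>G\<in>carrier holo_ring. G \<oplus>\<^bsub>holo_ring\<^esub> F = \<zero>\<^bsub>holo_ring\<^esub>"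
      by (intro bexI[of _ "\<lambda>p. - F p"]) (auto simp: holo_ring_simps)
  qed (auto simp: holo_ring_simps algebra_simps)
  show "comm_monoid holo_ring"
    by (rule comm_monoidI) (auto simp: holo_ring_simps algebra_simps)
qed (auto simp: holo_ring_simps algebra_simps)

interpretation holo: cring holo_ring
  by (rule cring_holo_ring)

lemma holo_a_inv: "holomorphic_near_0 F \<Longrightarrow> \<ominus>\<^bsub>holo_ring\<^esub> F = (\<lambda>p. - F p)"
  by (rule holo.add.inv_equality) (auto simp: holo_ring_simps)

lemma ideal_holo_ringI:
  assumes "I \<subseteq> carrier holo_ring" "(\<lambda>_. 0) \<in> I"
    and "\<And>F G. F \<in> I \<Longrightarrow> G \<in> I \<Longrightarrow> (\<lambda>p. F p + G p) \<in> I"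
    and "\<And>F G. F \<in> I \<Longrightarrow> holomorphic_near_0 G \<Longrightarrow> (\<lambda>p. G p * F p) \<in> I"
  shows "ideal I holo_ring"
proof (rule idealI)
  show "subgroup I (add_monoid holo_ring)"
  proof (rule holo.add.subgroupI)
    fix F assume F: "F \<in> I"
    have "holomorphic_near_0 F" using assms(1) F by (auto simp: holo_ring_simps)
    then show "\<ominus>\<^bsub>holo_ring\<^esub> F \<in> I"
      using assms(4)[OF F holomorphic_near_0_const[of "-1"]] by (simp add: holo_a_inv)
  qed (use assms in \<open>auto simp: holo_ring_simps\<close>)
qed (use assms in \<open>auto simp: holo_ring_simps mult.commute holo.ring_axioms\<close>)

lemma null_germ_iff: "F \<in> null_germ \<longleftrightarrow> holomorphic_near_0 F \<and> F \<sim>\<^sub>0 (\<lambda>_. 0)"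
  by (simp add: null_germ_def near_eq_def holo_ring_simps)

lemma ideal_null_germ: "ideal null_germ holo_ring"
proof (rule ideal_holo_ringI)
  show "(\<lambda>p. F p + G p) \<in> null_germ" if "F \<in> null_germ" "G \<in> null_germ" for F G
    using that near_eq_add[of F "\<lambda>_. 0" G "\<lambda>_. 0"] by (auto simp: null_germ_iff)
  show "(\<lambda>p. G p * F p) \<in> null_germ" if "F \<in> null_germ" "holomorphic_near_0 G" for F G
    using that near_eq_mult[OF near_eq_refl, of F "\<lambda>_. 0" G] by (auto simp: null_germ_iff)
qed (auto simp: null_germ_iff holo_ring_simps)

interpretation local_ring: cring local_ring
  unfolding local_ring_def by (rule ideal.quotient_is_cring[OF ideal_null_germ cring_holo_ring])

lemma ring_hom_germ: "ring_hom_ring holo_ring local_ring germ"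
  using ideal.rcos_ring_hom_ring[OF ideal_null_germ]
  by (simp add: local_ring_def germ_def[abs_def])

lemma carrier_local_ring: "carrier local_ring = germ ` Collect holomorphic_near_0"
  by (auto simp: local_ring_def FactRing_def A_RCOSETS_def' germ_def holo_ring_simps)

lemma germ_eqD:
  assumes "holomorphic_near_0 F" "germ F = germ G"
  shows "F \<sim>\<^sub>0 G"
proof -
  interpret N: ideal null_germ holo_ring by (rule ideal_null_germ)
  have "F \<in> null_germ +>\<^bsub>holo_ring\<^esub> G"
    using assms N.a_rcos_self[of F] by (simp add: germ_def holo_ring_simps)
  then obtain H where "H \<in> null_germ" "F = H \<oplus>\<^bsub>holo_ring\<^esub> G"
    by (auto simp: a_r_coset_def')
  then show ?thesis
    using near_eq_add[of H "\<lambda>_. 0" G G] by (simp add: null_germ_iff holo_ring_simps)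
qed

lemma germ_eqI:
  assumes "holomorphic_near_0 F" "holomorphic_near_0 G" "F \<sim>\<^sub>0 G"
  shows "germ F = germ G"
proof -
  have "(\<lambda>p. F p - G p) \<in> null_germ"
    using near_eq_diff[OF assms(3) near_eq_refl[of G]] assms by (auto simp: null_germ_iff)
  then have "F \<in> null_germ +>\<^bsub>holo_ring\<^esub> G"
    by (auto simp: a_r_coset_def' holo_ring_simps intro!: bexI[of _ "\<lambda>p. F p - G p"])
  then show ?thesis unfolding germ_def
    using holo.a_repr_independence[of F null_germ G] assms(2)
      additive_subgroup.a_subgroup[OF ideal.axioms(1)[OF ideal_null_germ]]
    by (simp add: holo_ring_simps)
qed

section \<open>The ideal, the residue classes and the dimension for a general pair\<close>

context
  fixes f g :: "complex poly poly"
  assumes hol: "holomorphic_near_0 (eval2 f)" "holomorphic_near_0 (eval2 g)"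
begin

lemma ideal_germ_ideal: "ideal (germ_ideal (eval2 f) (eval2 g)) holo_ring"
proof (rule ideal_holo_ringI)
  show "(\<lambda>_. 0) \<in> germ_ideal (eval2 f) (eval2 g)"
    by (rule germ_idealI[of _ "\<lambda>_. 0" "\<lambda>_. 0"]) auto
  show "germ_ideal (eval2 f) (eval2 g) \<subseteq> carrier holo_ring"
    by (auto simp: germ_ideal_def holo_ring_simps)
qed (rule germ_ideal_add germ_ideal_mult; assumption)+

text \<open>The image of an ideal in the ring of germs is an ideal; it contains both generators, so
  minimality gives one inclusion. The other holds since \<open>germ\<close> is a ring
  homomorphism.\<close>

lemma local_ideal_eq: "local_ideal f g = germ ` germ_ideal (eval2 f) (eval2 g)"
  unfolding local_ideal_def
proof (rule equalityI)
  have "ideal (germ ` germ_ideal (eval2 f) (eval2 g)) local_ring"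
    using holo.ring_ideal_imp_quot_ideal[OF ideal_null_germ ideal_germ_ideal]
    by (simp add: local_ring_def germ_def[abs_def])
  moreover have "eval2 f \<in> germ_ideal (eval2 f) (eval2 g)"
    using hol by (auto intro!: germ_idealI[of _ "\<lambda>_. 1" "\<lambda>_. 0"])
  moreover have "eval2 g \<in> germ_ideal (eval2 f) (eval2 g)"
    using hol by (auto intro!: germ_idealI[of _ "\<lambda>_. 0" "\<lambda>_. 1"])
  ultimately show "Idl\<^bsub>local_ring\<^esub> {germ (eval2 f), germ (eval2 g)} \<subseteq> germ ` germ_ideal (eval2 f) (eval2 g)"
    by (intro local_ring.genideal_minimal) auto
next
  have S: "{germ (eval2 f), germ (eval2 g)} \<subseteq> carrier local_ring"
    using hol by (auto simp: carrier_local_ring)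
  interpret J: ideal "Idl\<^bsub>local_ring\<^esub> {germ (eval2 f), germ (eval2 g)}" local_ring
    by (rule local_ring.genideal_ideal[OF S])
  note gen = local_ring.genideal_self[OF S]
  show "germ ` germ_ideal (eval2 f) (eval2 g) \<subseteq> Idl\<^bsub>local_ring\<^esub> {germ (eval2 f), germ (eval2 g)}"
  proof safe
    fix H assume "H \<in> germ_ideal (eval2 f) (eval2 g)"
    then obtain A B where H: "holomorphic_near_0 H" and AB: "holomorphic_near_0 A" "holomorphic_near_0 B"
      and eq: "H \<sim>\<^sub>0 (\<lambda>p. A p * eval2 f p + B p * eval2 g p)"
      unfolding germ_ideal_def by blast
    have "germ H = germ (\<lambda>p. A p * eval2 f p + B p * eval2 g p)"
      by (rule germ_eqI[OF H _ eq]) (use AB hol in auto)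
    also have "\<dots> = (germ A \<otimes>\<^bsub>local_ring\<^esub> germ (eval2 f)) \<oplus>\<^bsub>local_ring\<^esub> (germ B \<otimes>\<^bsub>local_ring\<^esub> germ (eval2 g))"
    proof -
      note h = ring_hom_ring.homh[OF ring_hom_germ]
      have "holomorphic_near_0 (\<lambda>p. A p * eval2 f p)" "holomorphic_near_0 (\<lambda>p. B p * eval2 g p)"
        using AB hol by auto
      then show ?thesis
        using ring_hom_add[OF h, of "\<lambda>p. A p * eval2 f p" "\<lambda>p. B p * eval2 g p"]
          ring_hom_mult[OF h, of A "eval2 f"] ring_hom_mult[OF h, of B "eval2 g"] AB hol
        by (simp add: holo_ring_simps)
    qed
    also have "\<dots> \<in> Idl\<^bsub>local_ring\<^esub> {germ (eval2 f), germ (eval2 g)}"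
      using gen AB by (intro J.a_closed J.I_l_closed) (auto simp: carrier_local_ring)
    finally show "germ H \<in> Idl\<^bsub>local_ring\<^esub> {germ (eval2 f), germ (eval2 g)}" .
  qed
qed

definition residue_class :: "(complex \<times> complex \<Rightarrow> complex) \<Rightarrow> (complex \<times> complex \<Rightarrow> complex) set set" where
  "residue_class F = local_ideal f g +>\<^bsub>local_ring\<^esub> germ F"

lemma ideal_local_ideal: "ideal (local_ideal f g) local_ring"
  using hol unfolding local_ideal_def
  by (intro local_ring.genideal_ideal) (auto simp: carrier_local_ring)

interpretation local_algebra: cring "local_algebra f g"
  unfolding local_algebra_def
  by (rule ideal.quotient_is_cring[OF ideal_local_ideal local_ring.is_cring])

lemma ring_hom_residue_class: "ring_hom_ring holo_ring (local_algebra f g) residue_class"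
proof (rule ring_hom_ringI2)
  have "residue_class = (\<lambda>x. local_ideal f g +>\<^bsub>local_ring\<^esub> x) \<circ> germ"
    by (auto simp: residue_class_def)
  then show "residue_class \<in> ring_hom holo_ring (local_algebra f g)"
    using ring_hom_trans[OF ring_hom_ring.homh[OF ring_hom_germ] ideal.rcos_ring_hom[OF ideal_local_ideal]]
    by (simp add: local_algebra_def)
qed (rule holo.ring_axioms local_algebra.ring_axioms)+

lemma carrier_local_algebra: "carrier (local_algebra f g) = residue_class ` Collect holomorphic_near_0"
  by (auto simp: local_algebra_def FactRing_def A_RCOSETS_def' residue_class_def carrier_local_ring)

text \<open>\<open>germ_ideal\<close> is stable under \<open>\<sim>\<^sub>0\<close>, so membership
  of a germ in the ideal passes back to every holomorphic representative.\<close>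

lemma residue_class_zero_iff:
  assumes F: "holomorphic_near_0 F"
  shows "residue_class F = \<zero>\<^bsub>local_algebra f g\<^esub> \<longleftrightarrow> F \<in> germ_ideal (eval2 f) (eval2 g)"
proof -
  interpret J: ideal "local_ideal f g" local_ring by (rule ideal_local_ideal)
  have "germ F \<in> carrier local_ring" using F by (auto simp: carrier_local_ring)
  then have "residue_class F = \<zero>\<^bsub>local_algebra f g\<^esub> \<longleftrightarrow> germ F \<in> local_ideal f g"
    using J.a_rcos_self J.a_rcos_const
    by (auto simp: residue_class_def local_algebra_def FactRing_def)
  also have "\<dots> \<longleftrightarrow> F \<in> germ_ideal (eval2 f) (eval2 g)"
    using F germ_eqD[OF F] by (auto simp: local_ideal_eq intro: germ_ideal_near_eq)
  finally show ?thesis .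
qed

lemma scalars_eq: "scalars f g = residue_class ` range (\<lambda>c _. c)"
  by (auto simp: scalars_def residue_class_def)

text \<open>The constants form a subfield of \<open>holo_ring\<close>, and its image is a subfield
  unless the quotient is the zero ring; the assumption excludes that case.\<close>

lemma subfield_scalars:
  assumes "(\<lambda>_. 1) \<notin> germ_ideal (eval2 f) (eval2 g)"
  shows "subfield (scalars f g) (local_algebra f g)"
  unfolding scalars_eq
proof (rule ring_hom_ring.img_is_subfield(2)[OF ring_hom_residue_class])
  have "residue_class (\<lambda>_. 1) \<noteq> \<zero>\<^bsub>local_algebra f g\<^esub>"
    using residue_class_zero_iff[OF holomorphic_near_0_const] assms by blast
  moreover have "residue_class (\<lambda>_. 1) = \<one>\<^bsub>local_algebra f g\<^esub>"
    using ring_hom_one[OF ring_hom_ring.homh[OF ring_hom_residue_class]] by (simp add: holo_ring_simps)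
  ultimately show "\<one>\<^bsub>local_algebra f g\<^esub> \<noteq> \<zero>\<^bsub>local_algebra f g\<^esub>" by simp
  let ?K = "range (\<lambda>c _. c) :: (complex \<times> complex \<Rightarrow> complex) set"
  have K: "subcring ?K holo_ring"
  proof (rule holo.subcringI')
    show "subring ?K holo_ring"
    proof (rule holo.subringI)
      fix F assume "F \<in> ?K"
      then obtain c where "F = (\<lambda>_. c)" by blast
      then show "\<ominus>\<^bsub>holo_ring\<^esub> F \<in> ?K" using holo_a_inv[OF holomorphic_near_0_const[of c]] by auto
    qed (auto simp: holo_ring_simps)
  qed
  show "subfield ?K holo_ring"
  proof (rule holo.subfieldI[OF K])
    show "Units (holo_ring\<lparr>carrier := ?K\<rparr>) = ?K - {\<zero>\<^bsub>holo_ring\<^esub>}"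
    proof (intro equalityI subsetI)
      fix F assume "F \<in> ?K - {\<zero>\<^bsub>holo_ring\<^esub>}"
      then obtain c where c: "F = (\<lambda>_. c)" "c \<noteq> 0" by (auto simp: holo_ring_simps)
      have "\<exists>x\<in>?K. x \<otimes>\<^bsub>holo_ring\<^esub> F = \<one>\<^bsub>holo_ring\<^esub> \<and> F \<otimes>\<^bsub>holo_ring\<^esub> x = \<one>\<^bsub>holo_ring\<^esub>"
        by (rule bexI[of _ "\<lambda>_. 1 / c"]) (use c in \<open>simp_all add: holo_ring_simps\<close>)
      then show "F \<in> Units (holo_ring\<lparr>carrier := ?K\<rparr>)"
        using c(1) by (simp add: Units_def)
    qed (fastforce simp: Units_def holo_ring_simps dest: fun_cong)
  qed
qed

text \<open>\<open>combine\<close> stops at the end of the shorter list. Missing coefficients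
  therefore count as 0 and surplus ones are dropped.\<close>

lemma combine_residue_class:
  assumes "\<And>M. M \<in> set Ms \<Longrightarrow> holomorphic_near_0 M"
  shows "local_algebra.combine (map residue_class (map (\<lambda>c _. c) cs)) (map residue_class Ms) =
    residue_class (\<lambda>p. \<Sum>i<length Ms. (if i < length cs then cs ! i else 0) * (Ms ! i) p)"
proof -
  have "holo.combine (map (\<lambda>c _. c) cs) Ms =
      (\<lambda>p. \<Sum>i<length Ms. (if i < length cs then cs ! i else 0) * (Ms ! i) p)"
  proof (induction cs Ms rule: list_induct2')
    case (4 c cs M Ms)
    show ?case
      unfolding list.map holo.combine.simps 4 length_Cons sum.lessThan_Suc_shift nth_Cons_Suc nth_Cons_0 holo_ring_simps
      by simp
  qed (simp_all add: holo_ring_simps)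
  then show ?thesis
    using ring_hom_ring.combine_hom[OF ring_hom_residue_class, of "map (\<lambda>c _. c) cs" Ms] assms
    by (auto simp: holo_ring_simps)
qed

lemma intersection_index_eq_length:
  assumes Ms: "\<And>M. M \<in> set Ms \<Longrightarrow> holomorphic_near_0 M" "Ms \<noteq> []"
    and span: "\<And>F. holomorphic_near_0 F \<Longrightarrow> F \<in> spanned (eval2 f) (eval2 g) Ms"
    and ind: "\<And>c i. (\<lambda>p. \<Sum>i<length Ms. c i * (Ms ! i) p) \<in> germ_ideal (eval2 f) (eval2 g) \<Longrightarrow>
      i < length Ms \<Longrightarrow> c i = 0"
  shows "intersection_index f g = enat (length Ms)"
proof -
  let ?A = "local_algebra f g" and ?Us = "map residue_class Ms"
  have sums: "holomorphic_near_0 (\<lambda>p. \<Sum>i<length Ms. c i * (Ms ! i) p)" for c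
    using Ms(1) by (intro holomorphic_near_0_sum holomorphic_near_0_mult holomorphic_near_0_const) auto
  \<comment> \<open>If 1 were in the ideal, so would be the sum of all members of \<open>Ms\<close>;
    its coefficients are 1, against independence. Nonemptiness of \<open>Ms\<close> supplies an
    index.\<close>
  have "(\<lambda>_. 1) \<notin> germ_ideal (eval2 f) (eval2 g)"
  proof
    assume "(\<lambda>_. 1) \<in> germ_ideal (eval2 f) (eval2 g)"
    from germ_ideal_mult[OF this sums[of "\<lambda>_. 1"]] ind[of "\<lambda>_. 1" 0] Ms(2)
    show False by simp
  qed
  then have K: "subfield (scalars f g) ?A" by (rule subfield_scalars)
  have Us: "set ?Us \<subseteq> carrier ?A" using Ms(1) by (auto simp: carrier_local_algebra)
  have scal: "\<exists>cs. Ks = map residue_class (map (\<lambda>c _. c) cs)" if "set Ks \<subseteq> scalars f g" for Ks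
    using that
  proof (induction Ks)
    case (Cons k Ks)
    then obtain cs c where "Ks = map residue_class (map (\<lambda>c _. c) cs)" "k = residue_class (\<lambda>_. c)"
      by (auto simp: scalars_eq)
    then show ?case by (intro exI[of _ "c # cs"]) simp
  qed simp
  have "local_algebra.independent (scalars f g) ?Us"
  proof (rule local_algebra.trivial_combine_imp_independent[OF K Us])
    fix Ks assume "set Ks \<subseteq> scalars f g" and 0: "local_algebra.combine Ks ?Us = \<zero>\<^bsub>?A\<^esub>"
    then obtain cs where Ks: "Ks = map residue_class (map (\<lambda>c _. c) cs)" using scal by blast
    \<comment> \<open>Padding by 0 turns a coefficient list of any length into a function to which
      \<open>ind\<close> applies.\<close>
    define d where "d i = (if i < length cs then cs ! i else 0)" for i
    have "local_algebra.combine Ks ?Us = residue_class (\<lambda>p. \<Sum>i<length Ms. d i * (Ms ! i) p)"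
      unfolding Ks d_def by (rule combine_residue_class[OF Ms(1)])
    then have "d i = 0" if "i < length Ms" for i
      using 0 ind[OF _ that] residue_class_zero_iff[OF sums[of d]] by simp
    then have "cs ! i = 0" if "i < length Ms" "i < length cs" for i
    proof -
      have "d i = 0" using \<open>\<And>i. i < length Ms \<Longrightarrow> d i = 0\<close> that by blast
      with that show ?thesis by (simp add: d_def)
    qed
    moreover have "residue_class (\<lambda>_. 0) = \<zero>\<^bsub>?A\<^esub>"
      using ring_hom_zero[OF ring_hom_ring.homh[OF ring_hom_residue_class] holo.ring_axioms local_algebra.ring_axioms] by (simp add: holo_ring_simps)
    \<comment> \<open>Only the scalars that actually meet a vector are constrained, hence
      \<open>take\<close>.\<close>
    ultimately show "set (take (length ?Us) Ks) \<subseteq> {\<zero>\<^bsub>?A\<^esub>}"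
      by (auto simp: Ks in_set_conv_nth)
  qed
  moreover have "local_algebra.Span (scalars f g) ?Us = carrier ?A"
  proof (rule equalityI[OF local_algebra.Span_in_carrier])
    show "carrier ?A \<subseteq> local_algebra.Span (scalars f g) ?Us"
    proof
      fix x assume "x \<in> carrier ?A"
      then obtain F where F: "holomorphic_near_0 F" "x = residue_class F"
        by (auto simp: carrier_local_algebra)
      obtain c where c: "(\<lambda>p. F p - (\<Sum>i<length Ms. c i * (Ms ! i) p)) \<in> germ_ideal (eval2 f) (eval2 g)"
        using span[OF F(1)] unfolding spanned_def by blast
      define S where "S = (\<lambda>p. \<Sum>i<length Ms. c i * (Ms ! i) p)"
      have S: "holomorphic_near_0 S" unfolding S_def by (rule sums)
      define D where "D = (\<lambda>p. F p - S p)"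
      have D: "holomorphic_near_0 D" unfolding D_def using F(1) S by auto
      have "F = D \<oplus>\<^bsub>holo_ring\<^esub> S" by (simp add: D_def holo_ring_simps)
      then have "residue_class F = residue_class D \<oplus>\<^bsub>?A\<^esub> residue_class S"
        using ring_hom_add[OF ring_hom_ring.homh[OF ring_hom_residue_class], of D S] D S
        by (simp add: holo_ring_simps)
      moreover have "residue_class D = \<zero>\<^bsub>?A\<^esub>"
        using c D residue_class_zero_iff by (simp add: D_def S_def)
      moreover have "residue_class S \<in> carrier ?A" using S by (auto simp: carrier_local_algebra)
      ultimately have "x = residue_class S" by (simp add: F(2))
      also have "S = (\<lambda>p. \<Sum>i<length Ms. (if i < length (map c [0..<length Ms]) then map c [0..<length Ms] ! i else 0) * (Ms ! i) p)"
        by (simp add: S_def)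
      also have "residue_class \<dots> = local_algebra.combine (map residue_class (map (\<lambda>c _. c) (map c [0..<length Ms]))) ?Us"
        by (rule combine_residue_class[OF Ms(1), symmetric])
      finally have "x = local_algebra.combine (map residue_class (map (\<lambda>c _. c) (map c [0..<length Ms]))) ?Us" .
      then show "x \<in> local_algebra.Span (scalars f g) ?Us"
        unfolding local_algebra.Span_eq_combine_set[OF K Us]
        by (intro CollectI exI[of _ "map residue_class (map (\<lambda>c _. c) (map c [0..<length Ms]))"] conjI)
          (auto simp: scalars_eq)
    qed
  qed (use K Us in \<open>auto simp: subfieldE(3)\<close>)
  ultimately have dim: "local_algebra.dimension (length Ms) (scalars f g) (carrier ?A)"
    using local_algebra.dimension_independent by force
  then show ?thesis
    unfolding intersection_index_def
    using local_algebra.finite_dimensionI[OF dim] local_algebra.dimI[OF K dim]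
    by (simp add: over_def)
qed

end

section \<open>The common curve pair\<close>

lemma coeff2_add: "coeff2 (p + q) i j = coeff2 p i j + coeff2 q i j"
  and coeff2_diff: "coeff2 (p - q) i j = coeff2 p i j - coeff2 q i j"
  and coeff2_minus: "coeff2 (- p) i j = - coeff2 p i j"
  and coeff2_0: "coeff2 0 i j = 0"
  by (simp_all add: coeff2_def)

lemma vY_power: "vY ^ i = [:Polynomial.monom 1 i:]"
  by (induction i) (simp_all add: vY_def Polynomial.monom_0 Polynomial.monom_Suc one_pCons)

lemma vZ_power: "vZ ^ j = Polynomial.monom 1 j"
proof (induction j)
  case 0
  then show ?case by (simp add: Polynomial.monom_0 one_pCons)
next
  case (Suc j)
  then show ?case by (simp add: vZ_def Polynomial.monom_Suc)
qed

lemma coeff2_monomial: "coeff2 (vY ^ i * vZ ^ j) k l = (if k = i \<and> l = j then 1 else 0)"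
  by (auto simp: coeff2_def vY_power vZ_power)

lemma cst_simps: "cst 0 = 0" "cst 1 = 1" "cst (a + b) = cst a + cst b" "cst (- a) = - cst a"
  by (simp_all add: cst_def one_pCons)

lemma hom_comp_add: "hom_comp d (p + q) = hom_comp d p + hom_comp d q"
  by (simp add: hom_comp_def coeff2_add cst_simps sum.distrib distrib_right)

lemma hom_comp_minus: "hom_comp d (- p) = - hom_comp d p"
  by (simp add: hom_comp_def coeff2_minus cst_simps sum_negf)

lemma hom_comp_diff: "hom_comp d (p - q) = hom_comp d p - hom_comp d q"
  using hom_comp_add[of d p "- q"] by (simp add: hom_comp_minus)

lemma hom_comp_monomial: "hom_comp d (vY ^ i * vZ ^ j) = (if i + j = d then vY ^ i * vZ ^ j else 0)"
proof -
  have "hom_comp d (vY ^ i * vZ ^ j) =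
      (\<Sum>k\<le>d. if k = i then (if i + j = d then vY ^ i * vZ ^ j else 0) else 0)"
    unfolding hom_comp_def
    by (rule sum.cong) (auto simp: coeff2_monomial cst_simps)
  then show ?thesis by auto
qed

text \<open>The simplifier rewrites exponents 0 and 1 away, after which the general rule no longer
  matches; the instances restore these cases.\<close>

lemmas hom_comp_simps = hom_comp_add hom_comp_diff hom_comp_minus
  hom_comp_monomial hom_comp_monomial[of _ 0, simplified] hom_comp_monomial[of _ _ 0, simplified]
  hom_comp_monomial[of _ 1, simplified] hom_comp_monomial[of _ _ 1, simplified]

definition curve_f :: "complex poly poly" where "curve_f = - (vY ^ 3 * vZ)"

definition curve_g :: "complex poly poly" where
  "curve_g = vY ^ 4 - vY ^ 2 * vZ - vY * vZ ^ 2 + vZ ^ 3"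

lemma hom_comp_curve_f: "hom_comp d curve_f = (if d = 4 then curve_f else 0)"
  by (simp add: curve_f_def hom_comp_simps)

lemma hom_comp_curve_g:
  "hom_comp d curve_g = (if d = 4 then vY ^ 4 else if d = 3 then - (vY ^ 2 * vZ) - vY * vZ ^ 2 + vZ ^ 3 else 0)"
  by (simp add: curve_g_def hom_comp_simps)

lemma curve_g_cubic_part_nonzero: "- (vY ^ 2 * vZ) - vY * vZ ^ 2 + vZ ^ 3 \<noteq> 0"
proof
  assume "- (vY ^ 2 * vZ) - vY * vZ ^ 2 + vZ ^ 3 = 0"
  \<comment> \<open>The coefficient of \<open>z^3\<close> is 1; all exponents are written out to fit
    \<open>coeff2_monomial\<close>.\<close>
  then have "coeff2 (- (vY ^ 2 * vZ ^ 1) - vY ^ 1 * vZ ^ 2 + vY ^ 0 * vZ ^ 3) 0 3 = coeff2 0 0 3"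
    by simp
  then show False
    by (simp only: coeff2_add coeff2_diff coeff2_minus coeff2_0 coeff2_monomial) simp
qed

lemma local_representation_curve: "local_representation 3 curve_f curve_g"
proof -
  \<comment> \<open>\<open>B\<close> and \<open>C\<close> are the homogenizations of
    \<open>f\<close> and \<open>g\<close> in degree 4, listed by powers of \<open>x\<close>. As
    \<open>y f_4 + z g_4 = 0\<close>, the sum \<open>y B + z C\<close> equals
    \<open>x z g_3\<close>, so \<open>A = - z g_3\<close> is forced.\<close>
  define A where "A = [:vY ^ 2 * vZ ^ 2 + vY ^ 1 * vZ ^ 3 - vY ^ 0 * vZ ^ 4:]"
  define B where "B = [:- (vY ^ 3 * vZ ^ 1):]"
  define C where "C = [:vY ^ 4 * vZ ^ 0, - (vY ^ 2 * vZ ^ 1) - vY ^ 1 * vZ ^ 2 + vY ^ 0 * vZ ^ 3:]"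
  note c2 = coeff2_add coeff2_diff coeff2_minus coeff2_0 coeff2_monomial
  have "homogeneous3 (3 + 1) A" "homogeneous3 (3 + 1) B" "homogeneous3 (3 + 1) C"
    unfolding homogeneous3_def A_def B_def C_def
    by (auto simp only: Polynomial.coeff_pCons c2 split: nat.splits if_splits) (auto simp: coeff2_0)
  moreover have "[:0, 1:] * A + [:vY:] * B + [:vZ:] * C = 0"
    by (simp add: A_def B_def C_def algebra_simps numeral_eq_Suc)
  moreover have "curve_f = poly B 1" "curve_g = poly C 1"
    by (simp_all add: curve_f_def curve_g_def B_def C_def)
  ultimately show ?thesis
    unfolding local_representation_def foliation_form_def by blast
qed

lemma has_algebraic_multiplicity_curve: "has_algebraic_multiplicity curve_f curve_g 3"
  using curve_g_cubic_part_nonzero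
  by (simp add: has_algebraic_multiplicity_def hom_comp_curve_f hom_comp_curve_g)

lemma eval2_curve: "eval2 curve_f = witness_f" "eval2 curve_g = witness_g"
  by (simp_all add: fun_eq_iff eval2_def curve_f_def curve_g_def witness_f_def witness_g_def vY_def vZ_def)

text \<open>The two values -1 cancel the summands \<open>+ 1\<close> in the cubic parts of
  \<open>f\<close>. The value 1 meets the nonvanishing conditions, and the zero at
  \<open>C (1,3) (4,0)\<close> removes \<open>z^4\<close> from \<open>f\<close>.\<close>

definition curve_coefficients :: coefficients where
  "curve_coefficients = (\<lambda>(h, k) (r, s). if (r, s) = (4, 0) then
     (if (h, k) = (0, 3) then 1 else if (h, k) = (2, 1) \<or> (h, k) = (1, 2) then -1 else 0) else 0)"

lemma family_G1_2_curve: "family_G1_2 curve_coefficients curve_f curve_g"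
  unfolding family_G1_2_def
  using local_representation_curve has_algebraic_multiplicity_curve
  by (auto simp: curve_coefficients_def curve_f_def curve_g_def cst_simps)

lemma family_G4_curve: "family_G4 curve_coefficients curve_f curve_g"
  unfolding family_G4_def
  using local_representation_curve has_algebraic_multiplicity_curve
  by (auto simp: curve_coefficients_def curve_f_def curve_g_def cst_simps)

lemma intersection_index_curve: "intersection_index curve_f curve_g = 13"
proof -
  have "intersection_index curve_f curve_g = enat (length (map monomial exponents))"
  proof (rule intersection_index_eq_length)
    show "F \<in> spanned (eval2 curve_f) (eval2 curve_g) (map monomial exponents)"
      if "holomorphic_near_0 F" for F
      unfolding eval2_curve using that by (rule witness_spanned)
    show "c i = 0" if "(\<lambda>p. \<Sum>i<length (map monomial exponents). c i * (map monomial exponents ! i) p)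
        \<in> germ_ideal (eval2 curve_f) (eval2 curve_g)" "i < length (map monomial exponents)" for c i
      using that unfolding eval2_curve length_map by (rule witness_independent)
  qed (auto simp: eval2_curve exponents_def)
  also have "length (map monomial exponents) = 13"
    by (simp add: exponents_def)
  finally show ?thesis by (simp add: numeral_eq_enat)
qed

theorem theorem6p3:
  shows "(\<exists>C f g. family_G1_2 C f g \<and> hom_comp 3 f = 0 \<and>
            f = hom_comp 4 f \<and> g = hom_comp 4 g + hom_comp 3 g \<and> hom_comp 3 g \<noteq> 0 \<and>
            intersection_index f g = 13) \<and>
         (\<exists>C f g. family_G4 C f g \<and> hom_comp 3 f = 0 \<and>
            f = hom_comp 4 f \<and> g = hom_comp 4 g + hom_comp 3 g \<and> hom_comp 3 g \<noteq> 0 \<and>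
            intersection_index f g = 13)"
proof -
  have "hom_comp 3 curve_f = 0" "curve_f = hom_comp 4 curve_f"
    "curve_g = hom_comp 4 curve_g + hom_comp 3 curve_g" "hom_comp 3 curve_g \<noteq> 0"
    using curve_g_cubic_part_nonzero
    by (simp_all add: hom_comp_curve_f hom_comp_curve_g) (simp add: curve_g_def)
  then show ?thesis
    using family_G1_2_curve family_G4_curve intersection_index_curve by blast
qed

end
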